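(* Let $T$ be a complete first-order theory with monster model $\mathfrak{C}$, let $A\subseteq B$ and let $p\in S(B)$ be a type which does not co-divide over $A$. If $p$ is NIP, then $p\restriction A$ is NIP. If $p$ is stable, then $p\restriction A$ is stable.
   Context: $T$ is a complete first-order theory in a language $\mathcal{L}$ and $\mathfrak{C}$ is its monster model; all parameter sets are subsets of $\mathfrak{C}$. Tuples may be infinite. For a property $t$, $\varphi^{(t)}$ is $\varphi$ if $t$ holds and $\neg\varphi$ otherwise. A type $\mathrm{tp}(a/B)$ co-divides over $A\subseteq B$ if $\mathrm{tp}(B/aA)$ divides over $A$. A partial type $\pi(x)$ has IP if there are a formula $\varphi(x,y)\in\mathcal{L}$ and a sequence $(a_i)_{i<\omega}$ of realizations of $\pi$ such that for every $s\subseteq\omega$ the set $\{\varphi(a_i,y)^{(i\in s)} : i<\omega\}$ is consistent; $\pi$ is NIP if it does not have IP. A partial type $\pi(x)$ over $A$ is stable if every extension $q\in S(C)$ of $\pi$, over every $C\supseteq A$, is definable. *)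

theory Defs
  imports Main
begin

unbundle cardinal_syntax

section \<open>First-order languages and formulas\<close>

text \<open>A language assigns arities to its symbols; the names outside the two domains are not
  symbols of it.\<close>

record ('f, 'r) lang =
  fun_ar :: "'f \<rightharpoonup> nat"
  rel_ar :: "'r \<rightharpoonup> nat"

text \<open>Free variables are named by elements of an arbitrary type \<open>'v\<close> (so that infinite tuples of
  variables are available), bound variables are de Bruijn indices. The map functions
  \<open>map_trm\<close> and \<open>map_fm\<close> act on the free variables only, hence are capture-avoiding
  substitutions of names for names.\<close>

datatype (dead 'f, fv_trm: 'v) trm =
    Var 'v
  | Bnd nat
  | App 'f "('f, 'v) trm list"

datatype (dead 'f, dead 'r, fv: 'v) fm =
    Eq "('f, 'v) trm" "('f, 'v) trm"
  | Rel 'r "('f, 'v) trm list"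
  | Neg "('f, 'r, 'v) fm"
  | And "('f, 'r, 'v) fm" "('f, 'r, 'v) fm"
  | Exists "('f, 'r, 'v) fm"

primrec wf_trm :: "('f, 'r) lang \<Rightarrow> nat \<Rightarrow> ('f, 'v) trm \<Rightarrow> bool" where
  "wf_trm L k (Var x) \<longleftrightarrow> True"
| "wf_trm L k (Bnd n) \<longleftrightarrow> n < k"
| "wf_trm L k (App f ts) \<longleftrightarrow> fun_ar L f = Some (length ts) \<and> list_all (wf_trm L k) ts"

primrec wf_fm :: "('f, 'r) lang \<Rightarrow> nat \<Rightarrow> ('f, 'r, 'v) fm \<Rightarrow> bool" where
  "wf_fm L k (Eq t u) \<longleftrightarrow> wf_trm L k t \<and> wf_trm L k u"
| "wf_fm L k (Rel r ts) \<longleftrightarrow> rel_ar L r = Some (length ts) \<and> list_all (wf_trm L k) ts"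
| "wf_fm L k (Neg \<phi>) \<longleftrightarrow> wf_fm L k \<phi>"
| "wf_fm L k (And \<phi> \<psi>) \<longleftrightarrow> wf_fm L k \<phi> \<and> wf_fm L k \<psi>"
| "wf_fm L k (Exists \<phi>) \<longleftrightarrow> wf_fm L (Suc k) \<phi>"

definition fmlas :: "('f, 'r) lang \<Rightarrow> 'v set \<Rightarrow> ('f, 'r, 'v) fm set" where
  "fmlas L X = {\<phi>. wf_fm L 0 \<phi> \<and> fv \<phi> \<subseteq> X}"

text \<open>\<open>\<phi>\<^sup>(\<^sup>t\<^sup>)\<close>: the formula itself if \<open>t\<close> holds, its negation otherwise.\<close>

definition signed :: "bool \<Rightarrow> ('f, 'r, 'v) fm \<Rightarrow> ('f, 'r, 'v) fm" where
  "signed t \<phi> = (if t then \<phi> else Neg \<phi>)"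


section \<open>Structures and satisfaction\<close>

text \<open>The universe of a structure is the whole type \<open>'m\<close>. Only the values at symbols of the language
  and at argument lists of the right length matter.\<close>

record ('f, 'r, 'm) struct =
  fun_int :: "'f \<Rightarrow> 'm list \<Rightarrow> 'm"
  rel_int :: "'r \<Rightarrow> 'm list \<Rightarrow> bool"

primrec eval_trm ::
  "('f, 'r, 'm) struct \<Rightarrow> (nat \<Rightarrow> 'm) \<Rightarrow> ('v \<Rightarrow> 'm) \<Rightarrow> ('f, 'v) trm \<Rightarrow> 'm" where
  "eval_trm M e v (Var x) = v x"
| "eval_trm M e v (Bnd n) = e n"
| "eval_trm M e v (App f ts) = fun_int M f (map (eval_trm M e v) ts)"

primrec sat_env ::
  "('f, 'r, 'm) struct \<Rightarrow> (nat \<Rightarrow> 'm) \<Rightarrow> ('v \<Rightarrow> 'm) \<Rightarrow> ('f, 'r, 'v) fm \<Rightarrow> bool" where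
  "sat_env M e v (Eq t u) \<longleftrightarrow> eval_trm M e v t = eval_trm M e v u"
| "sat_env M e v (Rel r ts) \<longleftrightarrow> rel_int M r (map (eval_trm M e v) ts)"
| "sat_env M e v (Neg \<phi>) \<longleftrightarrow> \<not> sat_env M e v \<phi>"
| "sat_env M e v (And \<phi> \<psi>) \<longleftrightarrow> sat_env M e v \<phi> \<and> sat_env M e v \<psi>"
| "sat_env M e v (Exists \<phi>) \<longleftrightarrow> (\<exists>x. sat_env M (case_nat x e) v \<phi>)"

text \<open>The environment for the de Bruijn indices is irrelevant for elements of \<open>fmlas\<close>, which have no
  dangling indices.\<close>

definition sat :: "('f, 'r, 'm) struct \<Rightarrow> ('v \<Rightarrow> 'm) \<Rightarrow> ('f, 'r, 'v) fm \<Rightarrow> bool" where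
  "sat M v \<phi> \<longleftrightarrow> sat_env M (\<lambda>_. undefined) v \<phi>"


section \<open>Formulas with parameters and types\<close>

text \<open>Tuples of elements are functions on an index set \<open>I\<close>, possibly infinite, of which only the values
  on \<open>I\<close> matter. A formula with parameters from \<open>A\<close> in the variables \<open>(x\<^sub>i)\<^sub>i\<^sub>\<in>\<^sub>I\<close> is an element of
  \<open>fmlas L (I <+> A)\<close>: the name \<open>Inl i\<close> is the variable \<open>x\<^sub>i\<close>, the name \<open>Inr c\<close> is the parameter \<open>c\<close>.
  A formula \<open>\<phi>(x, y)\<close> without parameters, where \<open>x\<close> is indexed by \<open>I\<close> and \<open>y\<close> is an \<open>n\<close>-tuple,
  is an element of \<open>fmlas L (I <+> {..<n})\<close>.\<close>

definition holds ::
  "('f, 'r, 'm) struct \<Rightarrow> ('i \<Rightarrow> 'm) \<Rightarrow> ('f, 'r, 'i + 'm) fm \<Rightarrow> bool" where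
  "holds M a \<phi> \<longleftrightarrow> sat M (case_sum a id) \<phi>"

definition realizes ::
  "('f, 'r, 'm) struct \<Rightarrow> ('i \<Rightarrow> 'm) \<Rightarrow> ('f, 'r, 'i + 'm) fm set \<Rightarrow> bool" where
  "realizes M a \<pi> \<longleftrightarrow> (\<forall>\<phi>\<in>\<pi>. holds M a \<phi>)"

text \<open>Consistency of a set of formulas with parameters in \<open>M\<close> is meant relative to the elementary
  diagram of \<open>M\<close>, that is, finite satisfiability in \<open>M\<close>.\<close>

definition consistent :: "('f, 'r, 'm) struct \<Rightarrow> ('f, 'r, 'i + 'm) fm set \<Rightarrow> bool" where
  "consistent M \<pi> \<longleftrightarrow> (\<forall>F. finite F \<and> F \<subseteq> \<pi> \<longrightarrow> (\<exists>a. realizes M a F))"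

definition partial_type ::
  "('f, 'r) lang \<Rightarrow> ('f, 'r, 'm) struct \<Rightarrow> 'i set \<Rightarrow> 'm set \<Rightarrow> ('f, 'r, 'i + 'm) fm set \<Rightarrow> bool" where
  "partial_type L M I A \<pi> \<longleftrightarrow> \<pi> \<subseteq> fmlas L (I <+> A) \<and> consistent M \<pi>"

text \<open>The space \<open>S\<^sub>I(A)\<close> of complete types over \<open>A\<close>.\<close>

definition complete_types ::
  "('f, 'r) lang \<Rightarrow> ('f, 'r, 'm) struct \<Rightarrow> 'i set \<Rightarrow> 'm set \<Rightarrow> ('f, 'r, 'i + 'm) fm set set" where
  "complete_types L M I A =
     {p. partial_type L M I A p \<and> (\<forall>\<phi>\<in>fmlas L (I <+> A). \<phi> \<in> p \<or> Neg \<phi> \<in> p)}"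

definition tp ::
  "('f, 'r) lang \<Rightarrow> ('f, 'r, 'm) struct \<Rightarrow> 'i set \<Rightarrow> ('i \<Rightarrow> 'm) \<Rightarrow> 'm set \<Rightarrow> ('f, 'r, 'i + 'm) fm set" where
  "tp L M I a A = {\<phi> \<in> fmlas L (I <+> A). holds M a \<phi>}"

definition restrict_type ::
  "('f, 'r) lang \<Rightarrow> 'i set \<Rightarrow> ('f, 'r, 'i + 'm) fm set \<Rightarrow> 'm set \<Rightarrow> ('f, 'r, 'i + 'm) fm set" where
  "restrict_type L I p A = p \<inter> fmlas L (I <+> A)"

text \<open>For \<open>\<phi>(x, y)\<close>: the formulas \<open>\<phi>(x, b)\<close> in the variables \<open>x\<close>, and \<open>\<phi>(a, y)\<close> in the variables \<open>y\<close>.\<close>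

definition inst_right :: "('j \<Rightarrow> 'm) \<Rightarrow> ('f, 'r, 'i + 'j) fm \<Rightarrow> ('f, 'r, 'i + 'm) fm" where
  "inst_right b \<phi> = map_fm (map_sum id b) \<phi>"

definition inst_left :: "('i \<Rightarrow> 'm) \<Rightarrow> ('f, 'r, 'i + 'j) fm \<Rightarrow> ('f, 'r, 'j + 'm) fm" where
  "inst_left a \<phi> = map_fm (case_sum (\<lambda>i. Inr (a i)) Inl) \<phi>"


section \<open>Complete theories and monster models\<close>

abbreviation sentences :: "('f, 'r) lang \<Rightarrow> ('f, 'r, nat) fm set" where
  "sentences L \<equiv> fmlas L {}"

definition models :: "('f, 'r, 'm) struct \<Rightarrow> ('f, 'r, nat) fm set \<Rightarrow> bool" where
  "models M T \<longleftrightarrow> (\<forall>\<phi>\<in>T. \<forall>v. sat M v \<phi>)"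

text \<open>Theories are taken to be deductively closed, so completeness is a matter of membership.
  Consistency and closure of such a \<open>T\<close> are consequences of its having a model, which is part of
  \<open>monster_model\<close> below.\<close>

definition complete_theory :: "('f, 'r) lang \<Rightarrow> ('f, 'r, nat) fm set \<Rightarrow> bool" where
  "complete_theory L T \<longleftrightarrow> T \<subseteq> sentences L \<and> (\<forall>\<phi>\<in>sentences L. \<phi> \<in> T \<or> Neg \<phi> \<in> T)"

definition automorphism :: "('f, 'r) lang \<Rightarrow> ('f, 'r, 'm) struct \<Rightarrow> ('m \<Rightarrow> 'm) \<Rightarrow> bool" where
  "automorphism L M g \<longleftrightarrow> bij g \<and>
     (\<forall>f xs. fun_ar L f = Some (length xs) \<longrightarrow> g (fun_int M f xs) = fun_int M f (map g xs)) \<and>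
     (\<forall>r xs. rel_ar L r = Some (length xs) \<longrightarrow> rel_int M r xs = rel_int M r (map g xs))"

definition partial_elementary ::
  "('f, 'r) lang \<Rightarrow> ('f, 'r, 'm) struct \<Rightarrow> 'm set \<Rightarrow> ('m \<Rightarrow> 'm) \<Rightarrow> bool" where
  "partial_elementary L M D h \<longleftrightarrow> (\<forall>\<phi>\<in>fmlas L D. sat M id \<phi> \<longleftrightarrow> sat M h \<phi>)"

definition saturated :: "('f, 'r) lang \<Rightarrow> ('f, 'r, 'm) struct \<Rightarrow> 'k rel \<Rightarrow> bool" where
  "saturated L M \<kappa> \<longleftrightarrow>
     (\<forall>A. |A| <o \<kappa> \<longrightarrow> (\<forall>p\<in>complete_types L M (UNIV :: unit set) A. \<exists>a. realizes M a p))"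

definition strongly_homogeneous :: "('f, 'r) lang \<Rightarrow> ('f, 'r, 'm) struct \<Rightarrow> 'k rel \<Rightarrow> bool" where
  "strongly_homogeneous L M \<kappa> \<longleftrightarrow>
     (\<forall>D h. |D| <o \<kappa> \<and> partial_elementary L M D h \<longrightarrow>
       (\<exists>g. automorphism L M g \<and> (\<forall>d\<in>D. g d = h d)))"

text \<open>The cardinal \<open>\<kappa>\<close> bounds the small sets and tuples: these are the ones of cardinality less than
  \<open>\<kappa>\<close>. It exceeds the number of formulas of the language.\<close>

definition monster_model ::
  "('f, 'r) lang \<Rightarrow> ('f, 'r, nat) fm set \<Rightarrow> 'k rel \<Rightarrow> ('f, 'r, 'm) struct \<Rightarrow> bool" where
  "monster_model L T \<kappa> M \<longleftrightarrow>
     Card_order \<kappa> \<and> natLeq <o \<kappa> \<and> |dom (fun_ar L)| <o \<kappa> \<and> |dom (rel_ar L)| <o \<kappa> \<and>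
     models M T \<and> saturated L M \<kappa> \<and> strongly_homogeneous L M \<kappa>"


section \<open>Dividing and co-dividing\<close>

text \<open>\<open>\<psi>(x, b)\<close> divides over \<open>A\<close> if there are \<open>b\<^sub>0, b\<^sub>1, \<dots>\<close> with the same type over \<open>A\<close> as \<open>b\<close> such that
  \<open>{\<psi>(x, b\<^sub>i) : i < \<omega>}\<close> is \<open>k\<close>-inconsistent for some \<open>k\<close>.\<close>

definition formula_divides ::
  "('f, 'r) lang \<Rightarrow> ('f, 'r, 'm) struct \<Rightarrow> 'i set \<Rightarrow> 'm set \<Rightarrow> ('f, 'r, 'i + 'm) fm \<Rightarrow> bool" where
  "formula_divides L M I A \<chi> \<longleftrightarrow>
     (\<exists>n \<psi> b. \<psi> \<in> fmlas L (I <+> {..<n::nat}) \<and> \<chi> = inst_right b \<psi> \<and>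
       (\<exists>(c :: nat \<Rightarrow> nat \<Rightarrow> 'm) k.
         (\<forall>i. tp L M {..<n} (c i) A = tp L M {..<n} b A) \<and>
         (\<forall>K. finite K \<and> card K = k \<longrightarrow> \<not> consistent M {inst_right (c i) \<psi> |i. i \<in> K})))"

text \<open>A partial type divides if it implies a formula, possibly with new parameters, that divides.\<close>

definition divides ::
  "('f, 'r) lang \<Rightarrow> ('f, 'r, 'm) struct \<Rightarrow> 'i set \<Rightarrow> 'm set \<Rightarrow> ('f, 'r, 'i + 'm) fm set \<Rightarrow> bool" where
  "divides L M I A \<pi> \<longleftrightarrow>
     (\<exists>\<chi>. formula_divides L M I A \<chi> \<and> (\<forall>a. realizes M a \<pi> \<longrightarrow> holds M a \<chi>))"

text \<open>In \<open>tp(B/aA)\<close> the set \<open>B\<close> is the tuple indexed by its own elements.\<close>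

definition codivides ::
  "('f, 'r) lang \<Rightarrow> ('f, 'r, 'm) struct \<Rightarrow> 'i set \<Rightarrow> 'm set \<Rightarrow> 'm set \<Rightarrow> ('f, 'r, 'i + 'm) fm set \<Rightarrow> bool"
where
  "codivides L M I A B p \<longleftrightarrow>
     (\<exists>a. p = tp L M I a B \<and> divides L M B A (tp L M B id (a ` I \<union> A)))"


section \<open>NIP and stable types\<close>

definition has_IP ::
  "('f, 'r) lang \<Rightarrow> ('f, 'r, 'm) struct \<Rightarrow> 'i set \<Rightarrow> ('f, 'r, 'i + 'm) fm set \<Rightarrow> bool" where
  "has_IP L M I \<pi> \<longleftrightarrow>
     (\<exists>n \<phi> (a :: nat \<Rightarrow> 'i \<Rightarrow> 'm). \<phi> \<in> fmlas L (I <+> {..<n::nat}) \<and>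
       (\<forall>i. realizes M (a i) \<pi>) \<and>
       (\<forall>s. consistent M {signed (i \<in> s) (inst_left (a i) \<phi>) |i. True}))"

definition NIP ::
  "('f, 'r) lang \<Rightarrow> ('f, 'r, 'm) struct \<Rightarrow> 'i set \<Rightarrow> ('f, 'r, 'i + 'm) fm set \<Rightarrow> bool" where
  "NIP L M I \<pi> \<longleftrightarrow> \<not> has_IP L M I \<pi>"

text \<open>A type over \<open>C\<close> is definable if every \<open>\<phi>(x, y)\<close> has a defining formula \<open>\<delta>(y)\<close> over \<open>C\<close> itself.\<close>

definition definable_type ::
  "('f, 'r) lang \<Rightarrow> ('f, 'r, 'm) struct \<Rightarrow> 'i set \<Rightarrow> 'm set \<Rightarrow> ('f, 'r, 'i + 'm) fm set \<Rightarrow> bool" where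
  "definable_type L M I C q \<longleftrightarrow>
     (\<forall>n. \<forall>\<phi>\<in>fmlas L (I <+> {..<n::nat}). \<exists>\<delta>\<in>fmlas L ({..<n} <+> C).
       \<forall>c. c ` {..<n} \<subseteq> C \<longrightarrow> (inst_right c \<phi> \<in> q \<longleftrightarrow> holds M c \<delta>))"

definition stable_type ::
  "('f, 'r) lang \<Rightarrow> ('f, 'r, 'm) struct \<Rightarrow> 'k rel \<Rightarrow> 'i set \<Rightarrow> 'm set \<Rightarrow> ('f, 'r, 'i + 'm) fm set \<Rightarrow> bool"
where
  "stable_type L M \<kappa> I A \<pi> \<longleftrightarrow>
     (\<forall>C q. A \<subseteq> C \<and> |C| <o \<kappa> \<and> q \<in> complete_types L M I C \<and> \<pi> \<subseteq> q \<longrightarrow> definable_type L M I C q)"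

end

theory Submission
  imports Defs "HOL-Library.Countable_Set" "HOL-Library.Infinite_Set" "HOL-Library.Nat_Bijection"
begin

text \<open>Both halves rest on one observation about finite configurations. Let \<open>\<alpha>\<^sub>0, \<alpha>\<^sub>1, \<dots>\<close> realize the
  restriction of \<open>p\<close> to \<open>A\<close>, and let \<open>P\<^sub>N\<close> be a first-order property without parameters that every
  increasing \<open>N\<close>-element subsequence of \<open>\<alpha>\<close> has. If \<open>p = tp(a/B)\<close> does not co-divide over \<open>A\<close>, then
  every \<open>\<theta>(x, b) \<in> p\<close> has \<open>N\<close> realizations forming a sequence with \<open>P\<^sub>N\<close>. Otherwise
  ``\<open>\<theta>(a, b)\<close> holds and no \<open>N\<close> realizations of \<open>\<theta>(x, b)\<close> have \<open>P\<^sub>N\<close>'' is a statement about \<open>b\<close> that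
  belongs to \<open>tp(B/aA)\<close>, so it does not divide over \<open>A\<close>. As each \<open>\<alpha>\<^sub>i\<close> has the type of \<open>a\<close> over
  \<open>A\<close>, some \<open>b'\<close> satisfies the statement with \<open>a\<close> replaced by each of \<open>N\<close> of the \<open>\<alpha>\<^sub>i\<close>. These
  \<open>\<alpha>\<^sub>i\<close> realize \<open>\<theta>(x, b')\<close> and have \<open>P\<^sub>N\<close>, which the statement excludes. Compactness then yields an
  infinite sequence of realizations of \<open>p\<close> with all the \<open>P\<^sub>N\<close> (\<open>noncodividing_transfer\<close>). Which of
  the \<open>\<alpha>\<^sub>i\<close> occur cannot be controlled, which is why \<open>P\<^sub>N\<close> has to hold of all the subsequences.

  For NIP, \<open>P\<^sub>N\<close> says that a formula shatters the sequence (\<open>has_IP_transfer\<close>).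

  For stability, \<open>P\<^sub>N\<close> says that the sequence is one side of a half graph of a formula \<open>\<phi>(x, y)\<close>.
  Half graphs are tied to definability by Shelah's 2-rank: a set of realizations has rank at least
  \<open>n\<close> if it splits along a full binary tree of height \<open>n\<close> of instances of \<open>\<phi>\<close> (\<open>branching\<close>).

    \<^item> If some formula of a complete type over \<open>C\<close> has finite rank, then one of least rank in the type
      yields a definition of its \<open>\<phi>\<close>-part over \<open>C\<close> (\<open>not_branching_imp_defining_formula\<close>). So a
      nondefinable extension of the restriction of \<open>p\<close> forces infinite rank.

    \<^item> High trees contain long half graphs, by a colouring argument on trees, and long half graphs
      contain high trees, by bisection (\<open>branching_imp_ladder\<close>, \<open>ladder_imp_branching\<close>). Since half
      graphs transfer, infinite rank of the restriction of \<open>p\<close> passes to \<open>p\<close>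
      (\<open>branches_infinitely_transfer\<close>).

    \<^item> If \<open>p\<close> has infinite rank, then one can repeatedly choose \<open>c\<close> and \<open>d\<close> of the same type over all
      parameters used so far and add \<open>\<not> \<phi>(x, c)\<close> and \<open>\<phi>(x, d)\<close>, retaining infinite rank
      (\<open>branching_equivalent_pair\<close>). After \<open>\<omega>\<close> steps no formula over the collected parameters can
      define the \<open>\<phi>\<close>-part of a completion, because its finitely many parameters occur before some step,
      whose \<open>c\<close> and \<open>d\<close> it cannot tell apart. So \<open>p\<close> is not stable (\<open>branches_infinitely_imp_unstable\<close>).\<close>

section \<open>Satisfaction, renaming and quantification over named variables\<close>

lemma eval_trm_cong:
  assumes "\<And>n. n < k \<Longrightarrow> e n = e' n" and "\<And>x. x \<in> fv_trm t \<Longrightarrow> v x = w x" and "wf_trm L k t"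
  shows "eval_trm M e v t = eval_trm M e' w t"
  using assms(2,3)
proof (induction t)
  case (App f ts)
  have "map (eval_trm M e v) ts = map (eval_trm M e' w) ts"
    using App by (auto simp: list_all_iff)
  then show ?case by (simp only: eval_trm.simps)
qed (auto simp: assms(1))

lemma sat_env_cong:
  assumes "\<And>n. n < k \<Longrightarrow> e n = e' n" and "\<And>x. x \<in> fv \<phi> \<Longrightarrow> v x = w x" and "wf_fm L k \<phi>"
  shows "sat_env M e v \<phi> \<longleftrightarrow> sat_env M e' w \<phi>"
  using assms
proof (induction \<phi> arbitrary: k e e')
  case (Eq t u)
  have "eval_trm M e v t = eval_trm M e' w t" "eval_trm M e v u = eval_trm M e' w u"
    by (rule eval_trm_cong[where k = k and L = L]; use Eq in auto)+
  then show ?case by simp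
next
  case (Rel r ts)
  have "eval_trm M e v t = eval_trm M e' w t" if "t \<in> set ts" for t
    by (rule eval_trm_cong[where k = k and L = L]) (use Rel that in \<open>auto simp: list_all_iff\<close>)
  then have "map (eval_trm M e v) ts = map (eval_trm M e' w) ts" by simp
  then show ?case by (simp only: sat_env.simps)
next
  case (Neg \<phi>)
  have "sat_env M e v \<phi> = sat_env M e' w \<phi>"
    by (rule Neg.IH[of k]) (use Neg.prems in auto)
  then show ?case by simp
next
  case (And \<phi> \<psi>)
  have "sat_env M e v \<phi> = sat_env M e' w \<phi>"
    by (rule And.IH(1)[of k]) (use And.prems in auto)
  moreover have "sat_env M e v \<psi> = sat_env M e' w \<psi>"
    by (rule And.IH(2)[of k]) (use And.prems in auto)
  ultimately show ?case by simp
next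
  case (Exists \<phi>)
  have "sat_env M (case_nat x e) v \<phi> = sat_env M (case_nat x e') w \<phi>" for x
    by (rule Exists.IH[of "Suc k"]) (use Exists.prems in \<open>auto split: nat.split\<close>)
  then show ?case by simp
qed

lemma sat_cong:
  assumes "\<And>x. x \<in> fv \<phi> \<Longrightarrow> v x = w x"
  shows "sat M v \<phi> \<longleftrightarrow> sat M w \<phi>"
proof -
  have *: "eval_trm M e v t = eval_trm M e w t" if "\<And>x. x \<in> fv_trm t \<Longrightarrow> v x = w x"
    for e t
    using that
  proof (induction t)
    case (App f ts)
    have "map (eval_trm M e v) ts = map (eval_trm M e w) ts" using App by auto
    then show ?case by (simp only: eval_trm.simps)
  qed auto
  have "sat_env M e v \<phi> \<longleftrightarrow> sat_env M e w \<phi>" for e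
    using assms
  proof (induction \<phi> arbitrary: e)
    case (Rel r ts)
    have "map (eval_trm M e v) ts = map (eval_trm M e w) ts" using Rel by (auto intro!: *)
    then show ?case by (simp only: sat_env.simps)
  qed (auto simp: *)
  then show ?thesis by (simp add: sat_def)
qed

lemma eval_trm_map: "eval_trm M e v (map_trm f t) = eval_trm M e (v \<circ> f) t"
proof (induction t)
  case (App g ts)
  have "map (eval_trm M e v) (map (map_trm f) ts) = map (eval_trm M e (v \<circ> f)) ts"
    unfolding map_map
    by (rule map_cong) (use App in \<open>auto simp del: comp_apply simp: comp_apply[of "eval_trm M e v"]\<close>)
  then show ?case by (simp only: eval_trm.simps trm.map)
qed auto

lemma sat_map: "sat M v (map_fm f \<phi>) \<longleftrightarrow> sat M (v \<circ> f) \<phi>"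
proof -
  have "sat_env M e v (map_fm f \<phi>) \<longleftrightarrow> sat_env M e (v \<circ> f) \<phi>" for e
  proof (induction \<phi> arbitrary: e)
    case (Rel r ts)
    have "map (eval_trm M e v) (map (map_trm f) ts) = map (eval_trm M e (v \<circ> f)) ts"
      by (simp add: eval_trm_map)
    then show ?case by (simp only: sat_env.simps fm.map)
  qed (auto simp: eval_trm_map)
  then show ?thesis by (simp add: sat_def)
qed

lemma wf_trm_map: "wf_trm L k (map_trm f t) \<longleftrightarrow> wf_trm L k t"
  by (induction t) (auto simp: list_all_iff)

lemma wf_fm_map: "wf_fm L k (map_fm f \<phi>) \<longleftrightarrow> wf_fm L k \<phi>"
  by (induction \<phi> arbitrary: k) (auto simp: wf_trm_map list_all_iff)

lemma map_fm_in_fmlas: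
  assumes "\<phi> \<in> fmlas L V" and "f ` V \<subseteq> W"
  shows "map_fm f \<phi> \<in> fmlas L W"
  using assms by (auto simp: fmlas_def wf_fm_map fm.set_map)

lemma sat_Neg [simp]: "sat M v (Neg \<phi>) \<longleftrightarrow> \<not> sat M v \<phi>"
  by (simp add: sat_def)

lemma sat_And [simp]: "sat M v (And \<phi> \<psi>) \<longleftrightarrow> sat M v \<phi> \<and> sat M v \<psi>"
  by (simp add: sat_def)

lemma holds_Neg [simp]: "holds M a (Neg \<phi>) \<longleftrightarrow> \<not> holds M a \<phi>"
  by (simp add: holds_def)

lemma Neg_in_fmlas [simp]: "Neg \<phi> \<in> fmlas L V \<longleftrightarrow> \<phi> \<in> fmlas L V"
  by (simp add: fmlas_def)

lemma And_in_fmlas: "\<phi> \<in> fmlas L V \<Longrightarrow> \<psi> \<in> fmlas L V \<Longrightarrow> And \<phi> \<psi> \<in> fmlas L V"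
  by (simp add: fmlas_def)

lemma fmlas_mono: "V \<subseteq> W \<Longrightarrow> fmlas L V \<subseteq> fmlas L W"
  by (auto simp: fmlas_def)

lemma finite_fv_trm: "finite (fv_trm t)"
  by (induction t) auto

lemma finite_fv: "finite (fv \<phi>)"
  by (induction \<phi>) (auto simp: finite_fv_trm)

lemma holds_cong:
  assumes "\<phi> \<in> fmlas L (X <+> C)" and "\<And>x. x \<in> X \<Longrightarrow> a x = b x"
  shows "holds M a \<phi> \<longleftrightarrow> holds M b \<phi>"
  unfolding holds_def by (rule sat_cong) (use assms in \<open>auto simp: fmlas_def split: sum.split\<close>)

text \<open>Existential quantification over a named variable: \<open>bind_fm x k\<close> replaces the name \<open>x\<close> by the
  index that refers to the quantifier about to be put in front, \<open>k\<close> being the number of quantifiers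
  passed on the way down.\<close>

primrec bind_trm :: "'v \<Rightarrow> nat \<Rightarrow> ('f, 'v) trm \<Rightarrow> ('f, 'v) trm" where
  "bind_trm x k (Var y) = (if y = x then Bnd k else Var y)"
| "bind_trm x k (Bnd n) = Bnd n"
| "bind_trm x k (App f ts) = App f (map (bind_trm x k) ts)"

primrec bind_fm :: "'v \<Rightarrow> nat \<Rightarrow> ('f, 'r, 'v) fm \<Rightarrow> ('f, 'r, 'v) fm" where
  "bind_fm x k (Eq t u) = Eq (bind_trm x k t) (bind_trm x k u)"
| "bind_fm x k (Rel r ts) = Rel r (map (bind_trm x k) ts)"
| "bind_fm x k (Neg \<phi>) = Neg (bind_fm x k \<phi>)"
| "bind_fm x k (And \<phi> \<psi>) = And (bind_fm x k \<phi>) (bind_fm x k \<psi>)"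
| "bind_fm x k (Exists \<phi>) = Exists (bind_fm x (Suc k) \<phi>)"

lemma eval_trm_bind: "eval_trm M e v (bind_trm x k t) = eval_trm M e (v(x := e k)) t"
proof (induction t)
  case (App g ts)
  have "map (eval_trm M e v) (map (bind_trm x k) ts) = map (eval_trm M e (v(x := e k))) ts"
    unfolding map_map by (rule map_cong) (use App in \<open>auto simp del: fun_upd_apply\<close>)
  then show ?case by (simp only: eval_trm.simps bind_trm.simps)
qed auto

lemma sat_env_bind: "sat_env M e v (bind_fm x k \<phi>) \<longleftrightarrow> sat_env M e (v(x := e k)) \<phi>"
proof (induction \<phi> arbitrary: e k)
  case (Rel r ts)
  have "map (eval_trm M e v) (map (bind_trm x k) ts) = map (eval_trm M e (v(x := e k))) ts"
    by (simp add: eval_trm_bind)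
  then show ?case by (simp only: sat_env.simps bind_fm.simps)
qed (auto simp: eval_trm_bind)

lemma wf_trm_bind: "wf_trm L k t \<Longrightarrow> wf_trm L (Suc k) (bind_trm x k t)"
  by (induction t) (auto simp: list_all_iff)

lemma wf_fm_bind: "wf_fm L k \<phi> \<Longrightarrow> wf_fm L (Suc k) (bind_fm x k \<phi>)"
  by (induction \<phi> arbitrary: k) (auto simp: wf_trm_bind list_all_iff)

lemma fv_trm_bind: "fv_trm (bind_trm x k t) = fv_trm t - {x}"
  by (induction t) auto

lemma fv_bind: "fv (bind_fm x k \<phi>) = fv \<phi> - {x}"
  by (induction \<phi> arbitrary: k) (auto simp: fv_trm_bind)

lemma sat_Exists_bind:
  assumes "wf_fm L 0 \<phi>"
  shows "sat M v (Exists (bind_fm x 0 \<phi>)) \<longleftrightarrow> (\<exists>m. sat M (v(x := m)) \<phi>)"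
proof -
  have "sat_env M (case_nat m (\<lambda>_. undefined)) (v(x := m)) \<phi> \<longleftrightarrow> sat M (v(x := m)) \<phi>" for m
    unfolding sat_def by (rule sat_env_cong[OF _ _ assms]) auto
  then show ?thesis by (simp add: sat_def sat_env_bind)
qed

lemma Exists_bind_in_fmlas: "\<phi> \<in> fmlas L V \<Longrightarrow> Exists (bind_fm x 0 \<phi>) \<in> fmlas L (V - {x})"
  by (auto simp: fmlas_def wf_fm_bind fv_bind)

text \<open>The set \<open>X\<close> may be infinite: only its finitely many elements that occur in \<open>\<phi>\<close> have to be
  quantified.\<close>

lemma exists_formula:
  assumes "\<phi> \<in> fmlas L V"
  obtains \<phi>' where "\<phi>' \<in> fmlas L (V - X)"
    and "\<And>v. sat M v \<phi>' \<longleftrightarrow> (\<exists>u. sat M (override_on v u X) \<phi>)"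
proof -
  have *: "\<exists>\<phi>' \<in> fmlas L (fv \<phi> - Y). \<forall>v. sat M v \<phi>' \<longleftrightarrow> (\<exists>u. sat M (override_on v u Y) \<phi>)"
    if "finite Y" for Y
    using that
  proof (induction Y)
    case empty
    then show ?case using assms by (intro bexI[of _ \<phi>]) (auto simp: fmlas_def)
  next
    case (insert y Y)
    then obtain \<phi>' where \<phi>': "\<phi>' \<in> fmlas L (fv \<phi> - Y)"
      and sat': "\<And>v. sat M v \<phi>' \<longleftrightarrow> (\<exists>u. sat M (override_on v u Y) \<phi>)" by blast
    have eq: "override_on (v(y := m)) u Y = override_on v (u(y := m)) (insert y Y)" for v u m
      using insert(2) by (auto simp: override_on_def)
    have "sat M v (Exists (bind_fm y 0 \<phi>')) \<longleftrightarrow> (\<exists>u. sat M (override_on v u (insert y Y)) \<phi>)" for v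
    proof -
      have "sat M v (Exists (bind_fm y 0 \<phi>')) \<longleftrightarrow>
          (\<exists>m u. sat M (override_on v (u(y := m)) (insert y Y)) \<phi>)"
        using \<phi>' by (subst sat_Exists_bind[of L]) (auto simp: fmlas_def sat' eq)
      also have "\<dots> \<longleftrightarrow> (\<exists>u. sat M (override_on v u (insert y Y)) \<phi>)"
        by (metis fun_upd_triv)
      finally show ?thesis .
    qed
    moreover have "fv \<phi> - insert y Y = fv \<phi> - Y - {y}" by blast
    then have "Exists (bind_fm y 0 \<phi>') \<in> fmlas L (fv \<phi> - insert y Y)"
      using Exists_bind_in_fmlas[OF \<phi>'] by simp
    ultimately show ?case by blast
  qed
  obtain \<phi>' where \<phi>': "\<phi>' \<in> fmlas L (fv \<phi> - (X \<inter> fv \<phi>))"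
    and sat': "\<And>v. sat M v \<phi>' \<longleftrightarrow> (\<exists>u. sat M (override_on v u (X \<inter> fv \<phi>)) \<phi>)"
    using *[of "X \<inter> fv \<phi>"] finite_fv[of \<phi>] by blast
  have sat'': "sat M v \<phi>' \<longleftrightarrow> (\<exists>u. sat M (override_on v u X) \<phi>)" for v
  proof -
    have "sat M (override_on v u (X \<inter> fv \<phi>)) \<phi> \<longleftrightarrow> sat M (override_on v u X) \<phi>" for u
      by (rule sat_cong) (auto simp: override_on_def)
    then show ?thesis by (simp add: sat')
  qed
  have "fv \<phi> - (X \<inter> fv \<phi>) \<subseteq> V - X" using assms by (auto simp: fmlas_def)
  then show ?thesis using that[of \<phi>'] \<phi>' sat'' fmlas_mono by blast
qed

section \<open>Definable predicates on tuples\<close>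

text \<open>The formula may use any variables. The set of variables that a predicate really needs is
  tracked separately by \<open>depends_only\<close> below, so the closure properties of definable predicates need
  no bookkeeping of variables.\<close>

definition definable_over ::
  "('f, 'r) lang \<Rightarrow> ('f, 'r, 'm) struct \<Rightarrow> 'm set \<Rightarrow> (('x \<Rightarrow> 'm) \<Rightarrow> bool) \<Rightarrow> bool" where
  "definable_over L M C P \<longleftrightarrow> (\<exists>\<phi>\<in>fmlas L (UNIV <+> C). \<forall>a. holds M a \<phi> \<longleftrightarrow> P a)"

lemma definable_overI:
  "\<phi> \<in> fmlas L (UNIV <+> C) \<Longrightarrow> (\<And>a. holds M a \<phi> \<longleftrightarrow> P a) \<Longrightarrow> definable_over L M C P"
  by (auto simp: definable_over_def)

lemma definable_holds:
  assumes "\<phi> \<in> fmlas L (X <+> C)"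
  shows "definable_over L M C (\<lambda>a. holds M a \<phi>)"
  using assms fmlas_mono[of "X <+> C" "UNIV <+> C" L] by (intro definable_overI[of \<phi>]) auto

lemma definable_sat:
  assumes "\<phi> \<in> fmlas L V"
  shows "definable_over L M C (\<lambda>a. sat M a \<phi>)"
proof (rule definable_overI)
  show "map_fm Inl \<phi> \<in> fmlas L (UNIV <+> C)" by (rule map_fm_in_fmlas[OF assms]) auto
qed (auto simp: holds_def sat_map comp_def)

lemma definable_not:
  assumes "definable_over L M C P"
  shows "definable_over L M C (\<lambda>a. \<not> P a)"
proof -
  obtain \<phi> where "\<phi> \<in> fmlas L (UNIV <+> C)" "\<And>a. holds M a \<phi> \<longleftrightarrow> P a"
    using assms by (auto simp: definable_over_def)
  then show ?thesis by (intro definable_overI[of "Neg \<phi>"]) auto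
qed

lemma definable_and:
  assumes "definable_over L M C P" and "definable_over L M C Q"
  shows "definable_over L M C (\<lambda>a. P a \<and> Q a)"
proof -
  obtain \<phi> where "\<phi> \<in> fmlas L (UNIV <+> C)" "\<And>a. holds M a \<phi> \<longleftrightarrow> P a"
    using assms(1) by (auto simp: definable_over_def)
  moreover obtain \<psi> where "\<psi> \<in> fmlas L (UNIV <+> C)" "\<And>a. holds M a \<psi> \<longleftrightarrow> Q a"
    using assms(2) by (auto simp: definable_over_def)
  ultimately show ?thesis by (intro definable_overI[of "And \<phi> \<psi>"]) (auto simp: And_in_fmlas holds_def)
qed

lemma definable_iff:
  assumes "definable_over L M C P" and "definable_over L M C Q"
  shows "definable_over L M C (\<lambda>a. P a \<longleftrightarrow> Q a)"
proof -
  have "definable_over L M C (\<lambda>a. \<not> (P a \<and> \<not> Q a) \<and> \<not> (\<not> P a \<and> Q a))"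
    by (intro definable_and definable_not assms)
  then show ?thesis by (rule back_subst[of "definable_over L M C"]) auto
qed

lemma definable_const: "definable_over L M C (\<lambda>a. b)"
proof -
  have "definable_over L M C (\<lambda>a. True)"
    by (rule definable_overI[of "Exists (Eq (Bnd 0) (Bnd 0))"]) (auto simp: fmlas_def holds_def sat_def)
  then show ?thesis using definable_not[of L M C "\<lambda>_. True"] by (cases b) auto
qed

lemma definable_Ball:
  assumes "finite J" and "\<And>j. j \<in> J \<Longrightarrow> definable_over L M C (P j)"
  shows "definable_over L M C (\<lambda>a. \<forall>j\<in>J. P j a)"
  using assms
proof (induction J)
  case (insert j J)
  then have "definable_over L M C (\<lambda>a. P j a \<and> (\<forall>j\<in>J. P j a))" by (intro definable_and) auto
  then show ?case by simp
qed (simp add: definable_const)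

lemma definable_subst:
  assumes "definable_over L M C P" and "\<And>y. f y \<in> UNIV <+> C"
  shows "definable_over L M C (\<lambda>a. P (\<lambda>y. case_sum a id (f y)))"
proof -
  obtain \<phi> where \<phi>: "\<phi> \<in> fmlas L (UNIV <+> C)" "\<And>a. holds M a \<phi> \<longleftrightarrow> P a"
    using assms by (auto simp: definable_over_def)
  have "map_fm (case_sum f Inr) \<phi> \<in> fmlas L (UNIV <+> C)"
    by (rule map_fm_in_fmlas[OF \<phi>(1)]) (use assms(2) in auto)
  moreover have "holds M a (map_fm (case_sum f Inr) \<phi>) \<longleftrightarrow> P (\<lambda>y. case_sum a id (f y))" for a
  proof -
    have "case_sum a id \<circ> case_sum f Inr = case_sum (\<lambda>y. case_sum a id (f y)) id"
      by (auto simp: fun_eq_iff split: sum.split)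
    then show ?thesis using \<phi>(2)[of "\<lambda>y. case_sum a id (f y)"] by (simp add: holds_def sat_map)
  qed
  ultimately show ?thesis by (rule definable_overI)
qed

lemma definable_rename:
  assumes "definable_over L M C P"
  shows "definable_over L M C (\<lambda>a. P (\<lambda>y. a (f y)))"
  using definable_subst[OF assms, of "Inl \<circ> f"] by (auto simp: comp_def)

lemma definable_ex:
  assumes "definable_over L M C P"
  shows "definable_over L M C (\<lambda>a. \<exists>b. P (case_sum a b))"
proof -
  obtain \<phi> where \<phi>: "\<phi> \<in> fmlas L (UNIV <+> C)" "\<And>a. holds M a \<phi> \<longleftrightarrow> P a"
    using assms by (auto simp: definable_over_def)
  obtain \<phi>' where \<phi>': "\<phi>' \<in> fmlas L ((UNIV <+> C) - Inl ` range Inr)"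
    and sat': "\<And>v. sat M v \<phi>' \<longleftrightarrow> (\<exists>u. sat M (override_on v u (Inl ` range Inr)) \<phi>)"
    using exists_formula[OF \<phi>(1), of "Inl ` range Inr" M] by blast
  define g :: "('d + 'e) + 'c \<Rightarrow> 'd + 'c"
    where "g = case_sum (case_sum Inl (\<lambda>_. undefined)) Inr"
  have "map_fm g \<phi>' \<in> fmlas L (UNIV <+> C)"
    by (rule map_fm_in_fmlas[OF \<phi>']) (auto simp: g_def image_iff split: sum.splits)
  moreover have "holds M a (map_fm g \<phi>') \<longleftrightarrow> (\<exists>b. P (case_sum a b))" for a
  proof -
    have eq: "override_on (case_sum a id \<circ> g) u (Inl ` range Inr)
        = case_sum (case_sum a (\<lambda>y. u (Inl (Inr y)))) id" for u
      by (auto simp: fun_eq_iff override_on_def g_def split: sum.split)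
    have "holds M a (map_fm g \<phi>') \<longleftrightarrow> (\<exists>u :: ('d + 'e) + 'c \<Rightarrow> 'c. P (case_sum a (\<lambda>y. u (Inl (Inr y)))))"
      by (simp add: holds_def sat_map sat' eq \<phi>(2)[unfolded holds_def])
    also have "\<dots> \<longleftrightarrow> (\<exists>b. P (case_sum a b))"
    proof
      assume "\<exists>b. P (case_sum a b)"
      then obtain b where "P (case_sum a b)" ..
      then show "\<exists>u :: ('d + 'e) + 'c \<Rightarrow> 'c. P (case_sum a (\<lambda>y. u (Inl (Inr y))))"
        by (intro exI[of _ "case_sum (case_sum a b) id"]) simp
    qed blast
    finally show ?thesis .
  qed
  ultimately show ?thesis by (rule definable_overI)
qed

definition depends_only :: "'x set \<Rightarrow> (('x \<Rightarrow> 'm) \<Rightarrow> bool) \<Rightarrow> bool" where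
  "depends_only X P \<longleftrightarrow> (\<forall>a b. (\<forall>x\<in>X. a x = b x) \<longrightarrow> P a = P b)"

text \<open>A formula that defines a predicate may have spurious variables; as the predicate does not depend
  on them, they can be quantified away.\<close>

lemma definable_formula:
  assumes "definable_over L M C P" and "depends_only X P"
  obtains \<phi> where "\<phi> \<in> fmlas L (X <+> C)" and "\<And>a. holds M a \<phi> \<longleftrightarrow> P a"
proof -
  obtain \<phi> where \<phi>: "\<phi> \<in> fmlas L (UNIV <+> C)" "\<And>a. holds M a \<phi> \<longleftrightarrow> P a"
    using assms by (auto simp: definable_over_def)
  obtain \<phi>' where \<phi>': "\<phi>' \<in> fmlas L ((UNIV <+> C) - Inl ` (- X))"
    and sat': "\<And>v. sat M v \<phi>' \<longleftrightarrow> (\<exists>u. sat M (override_on v u (Inl ` (- X))) \<phi>)"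
    using exists_formula[OF \<phi>(1), of "Inl ` (- X)" M] by blast
  have "(UNIV <+> C) - Inl ` (- X) \<subseteq> X <+> C" by auto
  then have "\<phi>' \<in> fmlas L (X <+> C)" using \<phi>' fmlas_mono by blast
  moreover have "holds M a \<phi>' \<longleftrightarrow> P a" for a
  proof -
    have "P (override_on a u (- X)) = P a" for u
      using assms(2) by (auto simp: depends_only_def override_on_def)
    moreover have "override_on (case_sum a id) u (Inl ` (- X))
        = case_sum (override_on a (u \<circ> Inl) (- X)) id" for u
      by (auto simp: fun_eq_iff override_on_def split: sum.split)
    ultimately show ?thesis using \<phi>(2) by (simp add: holds_def sat')
  qed
  ultimately show ?thesis by (rule that)
qed

lemma definable_mono: "definable_over L M C P \<Longrightarrow> C \<subseteq> D \<Longrightarrow> definable_over L M D P"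
  using fmlas_mono[of "UNIV <+> C" "UNIV <+> D" L] unfolding definable_over_def by fastforce

section \<open>Saturation for small sets of variables\<close>

text \<open>The Teichmueller--Tukey lemma.\<close>

lemma finite_character_maximal:
  assumes fc: "\<And>G. Q G \<longleftrightarrow> (\<forall>F. finite F \<and> F \<subseteq> G \<longrightarrow> Q F)" and "Q S"
  obtains G where "S \<subseteq> G" and "Q G" and "\<forall>x. Q (insert x G) \<longrightarrow> x \<in> G"
proof -
  have "\<exists>G\<in>{G. S \<subseteq> G \<and> Q G}. \<forall>X\<in>{G. S \<subseteq> G \<and> Q G}. G \<subseteq> X \<longrightarrow> X = G"
  proof (rule subset_Zorn_nonempty)
    show "{G. S \<subseteq> G \<and> Q G} \<noteq> {}" using \<open>Q S\<close> by auto
    fix \<C> assume ne: "\<C> \<noteq> {}" and ch: "subset.chain {G. S \<subseteq> G \<and> Q G} \<C>"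
    then have sub: "\<C> \<subseteq> {G. S \<subseteq> G \<and> Q G}" by (simp add: subset.chain_def)
    have "Q (\<Union>\<C>)"
    proof (subst fc, intro allI impI)
      fix F assume F: "finite F \<and> F \<subseteq> \<Union>\<C>"
      then obtain B where "B \<in> \<C>" "F \<subseteq> B"
        using finite_subset_Union_chain[OF _ _ ne ch, of F] by blast
      moreover have "Q B" using \<open>B \<in> \<C>\<close> sub by auto
      ultimately show "Q F" using F fc[of B] by blast
    qed
    then show "\<Union>\<C> \<in> {G. S \<subseteq> G \<and> Q G}" using ne sub by blast
  qed
  then obtain G where "S \<subseteq> G" "Q G" "\<And>X. S \<subseteq> X \<Longrightarrow> Q X \<Longrightarrow> G \<subseteq> X \<Longrightarrow> X = G" by auto
  then show ?thesis using that[of G] by blast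
qed

lemma consistent_extends_complete:
  assumes "\<pi> \<subseteq> fmlas L (X <+> C)" and "consistent M \<pi>"
  obtains q where "q \<in> complete_types L M X C" and "\<pi> \<subseteq> q"
proof -
  define Q where "Q \<sigma> \<longleftrightarrow> \<sigma> \<subseteq> fmlas L (X <+> C) \<and> consistent M \<sigma>" for \<sigma>
  have fc: "Q G \<longleftrightarrow> (\<forall>F. finite F \<and> F \<subseteq> G \<longrightarrow> Q F)" for G
  proof
    show "\<forall>F. finite F \<and> F \<subseteq> G \<longrightarrow> Q F" if "Q G"
      using that by (auto simp: Q_def consistent_def)
    show "Q G" if *: "\<forall>F. finite F \<and> F \<subseteq> G \<longrightarrow> Q F"
    proof -
      have "G \<subseteq> fmlas L (X <+> C)"
      proof
        fix x assume "x \<in> G"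
        then have "Q {x}" using * by simp
        then show "x \<in> fmlas L (X <+> C)" by (simp add: Q_def)
      qed
      moreover have "consistent M G" using * by (auto simp: Q_def consistent_def)
      ultimately show ?thesis by (simp add: Q_def)
    qed
  qed
  have "Q \<pi>" using assms by (simp add: Q_def)
  obtain q where "\<pi> \<subseteq> q" "Q q" and max: "\<forall>x. Q (insert x q) \<longrightarrow> x \<in> q"
    by (rule finite_character_maximal[OF fc \<open>Q \<pi>\<close>])
  have "\<phi> \<in> q \<or> Neg \<phi> \<in> q" if \<phi>: "\<phi> \<in> fmlas L (X <+> C)" for \<phi>
  proof (rule ccontr)
    assume "\<not> (\<phi> \<in> q \<or> Neg \<phi> \<in> q)"
    then have "\<not> consistent M (insert \<phi> q)" "\<not> consistent M (insert (Neg \<phi>) q)"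
      using max \<phi> \<open>Q q\<close> by (auto simp: Q_def)
    then obtain F1 F2 where F: "finite F1" "F1 \<subseteq> insert \<phi> q" "\<nexists>a. realizes M a F1"
        "finite F2" "F2 \<subseteq> insert (Neg \<phi>) q" "\<nexists>a. realizes M a F2"
      by (auto simp: consistent_def)
    have "finite (F1 \<union> F2 - {\<phi>, Neg \<phi>} )" "F1 \<union> F2 - {\<phi>, Neg \<phi>} \<subseteq> q" using F by auto
    moreover have "consistent M q" using \<open>Q q\<close> by (simp add: Q_def)
    ultimately obtain a where a: "realizes M a (F1 \<union> F2 - {\<phi>, Neg \<phi>})"
      unfolding consistent_def by blast
    show False
    proof (cases "holds M a \<phi>")
      case True
      then have "realizes M a F1" using a F(2) \<open>\<not> (\<phi> \<in> q \<or> Neg \<phi> \<in> q)\<close> by (auto simp: realizes_def)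
      then show False using F by blast
    next
      case False
      then have "realizes M a F2" using a F(5) \<open>\<not> (\<phi> \<in> q \<or> Neg \<phi> \<in> q)\<close> by (auto simp: realizes_def)
      then show False using F by blast
    qed
  qed
  then show ?thesis using that[of q] \<open>\<pi> \<subseteq> q\<close> \<open>Q q\<close>
    by (auto simp: complete_types_def partial_type_def Q_def)
qed

lemma infinite_Field_monster:
  assumes "monster_model L T \<kappa> M"
  shows "\<not> finite (Field \<kappa>)"
proof
  assume "finite (Field \<kappa>)"
  have "natLeq \<le>o \<kappa>" using assms by (simp add: monster_model_def ordLess_imp_ordLeq)
  then have "cinfinite \<kappa>" by (metis cinfinite_mono natLeq_cinfinite)
  then show False using \<open>finite (Field \<kappa>)\<close> by (simp add: cinfinite_def)
qed

lemma small_Un: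
  assumes "monster_model L T \<kappa> M" and "|A| <o \<kappa>" and "|B| <o \<kappa>"
  shows "|A \<union> B| <o \<kappa>"
  using card_of_Un_ordLess_infinite_Field[OF infinite_Field_monster[OF assms(1)] _ assms(2,3)] assms(1)
  by (simp add: monster_model_def)

lemma small_countable:
  fixes A :: "'a set"
  assumes "monster_model L T \<kappa> M" and "countable A"
  shows "|A| <o \<kappa>"
proof -
  obtain f :: "'a \<Rightarrow> nat" where "inj_on f A" using assms(2) by (auto simp: countable_def)
  then have "|A| \<le>o |UNIV :: nat set|" using card_of_ordLeq by blast
  also have "|UNIV :: nat set| =o natLeq" by (rule card_of_nat)
  also have "natLeq <o \<kappa>" using assms(1) by (simp add: monster_model_def)
  finally show ?thesis .
qed

lemma small_Times_nat:
  fixes A :: "'a set"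
  assumes "monster_model L T \<kappa> M" and "|A| <o \<kappa>"
  shows "|(UNIV :: nat set) \<times> A| <o \<kappa>"
proof (cases "finite A")
  case True
  then have "countable ((UNIV :: nat set) \<times> A)" by (simp add: countable_finite)
  then show ?thesis by (rule small_countable[OF assms(1)])
next
  case False
  then have "|UNIV :: nat set| \<le>o |A|" by (simp add: infinite_iff_card_of_nat)
  then have "|(UNIV :: nat set) \<times> A| \<le>o |A|"
    using False Field_card_of[of A]
    by (intro card_of_Times_ordLeq_infinite_Field)
      (simp_all add: card_of_card_order_on ordIso_imp_ordLeq[OF card_of_refl])
  then show ?thesis using assms(2) ordLeq_ordLess_trans by blast
qed

text \<open>Saturation is given for one variable. Fix a maximal set \<open>G\<close> of equations \<open>x = m\<close> that is finitely
  satisfiable together with \<open>\<Pi>\<close>. Such a \<open>G\<close> gives at most one value to each variable, so it uses few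
  parameters, and one-variable saturation over these shows that it gives a value to every variable.
  The assignment obtained in this way realizes \<open>\<Pi>\<close>, as each formula involves finitely many
  variables.\<close>

lemma saturation:
  fixes M :: "('f, 'r, 'm) struct" and X :: "'x set"
  assumes monster: "monster_model L T \<kappa> M" and X: "|X| <o \<kappa>" and C: "|C| <o \<kappa>"
    and \<Pi>: "\<Pi> \<subseteq> fmlas L (X <+> C)" and con: "consistent M \<Pi>"
  shows "\<exists>a. realizes M a \<Pi>"
proof -
  define Q where "Q G \<longleftrightarrow> G \<subseteq> X \<times> UNIV \<and>
      (\<forall>F G0. finite F \<and> F \<subseteq> \<Pi> \<and> finite G0 \<and> G0 \<subseteq> G \<longrightarrow>
        (\<exists>a. realizes M a F \<and> (\<forall>e\<in>G0. a (fst e) = snd e)))" for G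
  have fc: "Q G \<longleftrightarrow> (\<forall>F. finite F \<and> F \<subseteq> G \<longrightarrow> Q F)" for G
  proof
    show "\<forall>F. finite F \<and> F \<subseteq> G \<longrightarrow> Q F" if "Q G"
      using that unfolding Q_def by (meson subset_trans)
    show "Q G" if *: "\<forall>F. finite F \<and> F \<subseteq> G \<longrightarrow> Q F"
    proof -
      have "G \<subseteq> X \<times> UNIV"
      proof
        fix e assume "e \<in> G"
        then have "Q {e}" using * by simp
        then show "e \<in> X \<times> UNIV" by (simp add: Q_def)
      qed
      moreover have "\<exists>a. realizes M a F \<and> (\<forall>e\<in>G0. a (fst e) = snd e)"
        if "finite F" "F \<subseteq> \<Pi>" "finite G0" "G0 \<subseteq> G" for F G0
      proof -
        have "Q G0" using * that by blast
        then show ?thesis using that by (simp add: Q_def)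
      qed
      ultimately show ?thesis by (simp add: Q_def)
    qed
  qed
  have "Q {}" using con by (simp add: Q_def consistent_def)
  obtain G where "{} \<subseteq> G" and G: "Q G" and max: "\<forall>e. Q (insert e G) \<longrightarrow> e \<in> G"
    by (rule finite_character_maximal[OF fc \<open>Q {}\<close>])
  have fin: "\<exists>a. realizes M a F \<and> (\<forall>e\<in>G0. a (fst e) = snd e)"
    if "finite F" "F \<subseteq> \<Pi>" "finite G0" "G0 \<subseteq> G" for F G0
    using G that by (simp add: Q_def)
  have single: "m = m'" if "(x, m) \<in> G" "(x, m') \<in> G" for x m m'
  proof -
    have "\<exists>a. realizes M a {} \<and> (\<forall>e\<in>{(x, m), (x, m')}. a (fst e) = snd e)"
      by (rule fin) (use that in auto)
    then show ?thesis by auto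
  qed
  have "inj_on fst G" using single by (auto simp: inj_on_def)
  moreover have "fst ` G \<subseteq> X" using G by (auto simp: Q_def)
  ultimately have "|G| \<le>o |X|" by (metis card_of_ordLeq)
  then have "|G| <o \<kappa>" using X by (rule ordLeq_ordLess_trans)
  then have "|snd ` G| <o \<kappa>" by (rule ordLeq_ordLess_trans[OF card_of_image])
  then have D: "|C \<union> snd ` G| <o \<kappa>" by (rule small_Un[OF monster C])
  have total: "\<exists>m. (x, m) \<in> G" if "x \<in> X" for x
  proof -
    \<comment> \<open>The condition on a value \<open>m\<close> of \<open>x\<close> to be compatible with given finite parts of \<open>\<Pi>\<close> and \<open>G\<close>.\<close>
    define E where "E F G0 m \<longleftrightarrow> (\<exists>a. (\<forall>\<phi>\<in>F. holds M a \<phi>) \<and> (\<forall>e\<in>G0. a (fst e) = snd e) \<and> a x = m)"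
      for F :: "('f, 'r, 'x + 'm) fm set" and G0 m
    define \<sigma> where "\<sigma> = {\<psi> \<in> fmlas L ((UNIV :: unit set) <+> (C \<union> snd ` G)).
      \<exists>F G0. finite F \<and> F \<subseteq> \<Pi> \<and> finite G0 \<and> G0 \<subseteq> G \<and> (\<forall>b. holds M b \<psi> \<longleftrightarrow> E F G0 (b ()))}"
    have E_formula: "\<exists>\<psi>\<in>\<sigma>. \<forall>b. holds M b \<psi> \<longleftrightarrow> E F G0 (b ())"
      if fin': "finite F" "F \<subseteq> \<Pi>" "finite G0" "G0 \<subseteq> G" for F G0
    proof -
      have var: "definable_over L M (C \<union> snd ` G) (\<lambda>v :: unit + 'x \<Rightarrow> 'm. v y = v z)" for y z
        by (rule definable_overI[of "Eq (Var (Inl y)) (Var (Inl z))"])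
          (auto simp: fmlas_def holds_def sat_def)
      have par: "definable_over L M (C \<union> snd ` G) (\<lambda>v :: unit + 'x \<Rightarrow> 'm. v y = d)"
        if "d \<in> snd ` G" for y d
        using that by (intro definable_overI[of "Eq (Var (Inl y)) (Var (Inr d))"])
          (auto simp: fmlas_def holds_def sat_def)
      have "definable_over L M (C \<union> snd ` G) (\<lambda>v :: unit + 'x \<Rightarrow> 'm.
          (\<forall>\<phi>\<in>F. holds M (\<lambda>y. v (Inr y)) \<phi>) \<and> (\<forall>e\<in>G0. v (Inr (fst e)) = snd e)
            \<and> v (Inr x) = v (Inl ()))"
      proof (intro definable_and definable_Ball fin' var)
        fix \<phi> assume "\<phi> \<in> F"
        then have "\<phi> \<in> fmlas L (X <+> C)" using fin' \<Pi> by blast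
        then have "definable_over L M C (\<lambda>a. holds M a \<phi>)" by (rule definable_holds)
        then have "definable_over L M (C \<union> snd ` G) (\<lambda>a. holds M a \<phi>)"
          by (rule definable_mono) simp
        then show "definable_over L M (C \<union> snd ` G) (\<lambda>v :: unit + 'x \<Rightarrow> 'm. holds M (\<lambda>y. v (Inr y)) \<phi>)"
          by (rule definable_rename)
      next
        fix e assume "e \<in> G0"
        then show "definable_over L M (C \<union> snd ` G) (\<lambda>v :: unit + 'x \<Rightarrow> 'm. v (Inr (fst e)) = snd e)"
          using fin' by (intro par) auto
      qed
      from definable_ex[OF this]
      have "definable_over L M (C \<union> snd ` G) (\<lambda>b :: unit \<Rightarrow> 'm. E F G0 (b ()))"
        by (simp add: E_def)
      then obtain \<psi> where \<psi>: "\<psi> \<in> fmlas L ((UNIV :: unit set) <+> (C \<union> snd ` G))"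
        "\<And>b. holds M b \<psi> \<longleftrightarrow> E F G0 (b ())"
        by (auto simp: definable_over_def)
      then have "\<psi> \<in> \<sigma>" using fin' unfolding \<sigma>_def by blast
      then show ?thesis using \<psi> by blast
    qed
    have "consistent M \<sigma>"
      unfolding consistent_def
    proof (intro allI impI)
      fix H assume H: "finite H \<and> H \<subseteq> \<sigma>"
      then have "\<forall>\<psi>\<in>H. \<exists>F G0. finite F \<and> F \<subseteq> \<Pi> \<and> finite G0 \<and> G0 \<subseteq> G \<and>
          (\<forall>b. holds M b \<psi> \<longleftrightarrow> E F G0 (b ()))" unfolding \<sigma>_def by blast
      then obtain F G0 where FG: "\<And>\<psi>. \<psi> \<in> H \<Longrightarrow> finite (F \<psi>) \<and> F \<psi> \<subseteq> \<Pi> \<and>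
          finite (G0 \<psi>) \<and> G0 \<psi> \<subseteq> G \<and> (\<forall>b. holds M b \<psi> \<longleftrightarrow> E (F \<psi>) (G0 \<psi>) (b ()))"
        by metis
      have "finite (\<Union>(F ` H))" "\<Union>(F ` H) \<subseteq> \<Pi>" "finite (\<Union>(G0 ` H))" "\<Union>(G0 ` H) \<subseteq> G"
        using H FG by auto
      then obtain a where a: "realizes M a (\<Union>(F ` H))" "\<forall>e\<in>\<Union>(G0 ` H). a (fst e) = snd e"
        using fin by meson
      have "holds M (\<lambda>_. a x) \<psi>" if "\<psi> \<in> H" for \<psi>
        using FG[OF that] a that unfolding E_def realizes_def by fastforce
      then show "\<exists>b. realizes M b H" by (auto simp: realizes_def)
    qed
    moreover have "\<sigma> \<subseteq> fmlas L (UNIV <+> (C \<union> snd ` G))" by (auto simp: \<sigma>_def)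
    ultimately obtain q where q: "q \<in> complete_types L M UNIV (C \<union> snd ` G)" "\<sigma> \<subseteq> q"
      using consistent_extends_complete by blast
    then obtain b where "realizes M b q"
      using monster D unfolding monster_model_def saturated_def by blast
    then have b: "E F G0 (b ())" if "finite F" "F \<subseteq> \<Pi>" "finite G0" "G0 \<subseteq> G" for F G0
      using E_formula[OF that] q(2) by (auto simp: realizes_def)
    have "Q (insert (x, b ()) G)"
      unfolding Q_def
    proof (intro conjI allI impI)
      show "insert (x, b ()) G \<subseteq> X \<times> UNIV" using G \<open>x \<in> X\<close> by (auto simp: Q_def)
      fix F G0 assume "finite F \<and> F \<subseteq> \<Pi> \<and> finite G0 \<and> G0 \<subseteq> insert (x, b ()) G"
      then have "E F (G0 - {(x, b ())}) (b ())" by (intro b) auto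
      then show "\<exists>a. realizes M a F \<and> (\<forall>e\<in>G0. a (fst e) = snd e)"
        unfolding E_def realizes_def by fastforce
    qed
    then show ?thesis using max by blast
  qed
  then obtain a where a: "\<And>x. x \<in> X \<Longrightarrow> (x, a x) \<in> G" by metis
  have "holds M a \<phi>" if "\<phi> \<in> \<Pi>" for \<phi>
  proof -
    let ?Y = "X \<inter> Inl -` fv \<phi>"
    have "finite ((\<lambda>x. (x, a x)) ` ?Y)" using finite_fv[of \<phi>] by (simp add: finite_vimageI)
    moreover have "(\<lambda>x. (x, a x)) ` ?Y \<subseteq> G" using a by auto
    moreover have "finite {\<phi>}" "{\<phi>} \<subseteq> \<Pi>" using that by auto
    ultimately obtain b where b: "realizes M b {\<phi>}" "\<forall>e\<in>(\<lambda>x. (x, a x)) ` ?Y. b (fst e) = snd e"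
      using fin by meson
    have "holds M b \<phi> \<longleftrightarrow> holds M a \<phi>"
      unfolding holds_def
    proof (rule sat_cong)
      fix z assume z: "z \<in> fv \<phi>"
      moreover have "fv \<phi> \<subseteq> X <+> C" using that \<Pi> by (auto simp: fmlas_def)
      ultimately have "z \<in> X <+> C" by blast
      then show "case_sum b id z = case_sum a id z"
      proof (rule PlusE)
        fix x assume x: "x \<in> X" "z = Inl x"
        then have "(x, a x) \<in> (\<lambda>x. (x, a x)) ` ?Y" using z by auto
        then show ?thesis using b(2) x by fastforce
      qed simp
    qed
    then show ?thesis using b(1) by (simp add: realizes_def)
  qed
  then show ?thesis by (auto simp: realizes_def)
qed

lemma definable_saturation:
  fixes X :: "'x set"
  assumes monster: "monster_model L T \<kappa> M" and X: "|X| <o \<kappa>" and C: "|C| <o \<kappa>"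
    and def: "\<And>P. P \<in> \<P> \<Longrightarrow> definable_over L M C P" and dep: "\<And>P. P \<in> \<P> \<Longrightarrow> depends_only X P"
    and fin: "\<And>\<F>. finite \<F> \<Longrightarrow> \<F> \<subseteq> \<P> \<Longrightarrow> \<exists>a. \<forall>P\<in>\<F>. P a"
  obtains a where "\<forall>P\<in>\<P>. P a"
proof -
  define \<Pi> where "\<Pi> = {\<phi> \<in> fmlas L (X <+> C). (\<lambda>a. holds M a \<phi>) \<in> \<P>}"
  have "consistent M \<Pi>"
    unfolding consistent_def realizes_def
  proof (intro allI impI)
    fix F assume "finite F \<and> F \<subseteq> \<Pi>"
    then show "\<exists>a. \<forall>\<phi>\<in>F. holds M a \<phi>"
      using fin[of "(\<lambda>\<phi> a. holds M a \<phi>) ` F"] by (auto simp: \<Pi>_def)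
  qed
  moreover have "\<Pi> \<subseteq> fmlas L (X <+> C)" by (auto simp: \<Pi>_def)
  ultimately obtain a where a: "realizes M a \<Pi>" using saturation[OF monster X C] by blast
  have "\<forall>P\<in>\<P>. P a"
  proof
    fix P assume "P \<in> \<P>"
    obtain \<phi> where \<phi>: "\<phi> \<in> fmlas L (X <+> C)" "\<And>a. holds M a \<phi> \<longleftrightarrow> P a"
      using definable_formula[of L M C P X] def[of P] dep[of P] \<open>P \<in> \<P>\<close> by metis
    then have "(\<lambda>a. holds M a \<phi>) = P" by auto
    then have "\<phi> \<in> \<Pi>" using \<phi> \<open>P \<in> \<P>\<close> by (simp add: \<Pi>_def)
    then show "P a" using a \<phi>(2) by (auto simp: realizes_def)
  qed
  then show ?thesis by (rule that)
qed

text \<open>The form in which compactness is applied: the sets \<open>S i\<close> form a downward directed family of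
  nonempty sets, each member of \<open>\<P>\<close> contains one of them, and hence \<open>\<P>\<close> is finitely satisfiable.\<close>

lemma definable_saturation_directed:
  fixes X :: "'x set" and S :: "'s \<Rightarrow> ('x \<Rightarrow> 'm) \<Rightarrow> bool"
  assumes "monster_model L T \<kappa> M" and "|X| <o \<kappa>" and "|C| <o \<kappa>"
    and def: "\<And>P. P \<in> \<P> \<Longrightarrow> definable_over L M C P" and dep: "\<And>P. P \<in> \<P> \<Longrightarrow> depends_only X P"
    and ne: "K \<noteq> {}" and sat: "\<And>i. i \<in> K \<Longrightarrow> \<exists>a. S i a"
    and dir: "\<And>i j. i \<in> K \<Longrightarrow> j \<in> K \<Longrightarrow> \<exists>k\<in>K. \<forall>a. S k a \<longrightarrow> S i a \<and> S j a"
    and imp: "\<And>P. P \<in> \<P> \<Longrightarrow> \<exists>i\<in>K. \<forall>a. S i a \<longrightarrow> P a"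
  obtains a where "\<forall>P\<in>\<P>. P a"
proof (rule definable_saturation[OF assms(1-3) def dep])
  fix \<F> assume "finite \<F>" "\<F> \<subseteq> \<P>"
  define all where "all \<F> a \<longleftrightarrow> (\<forall>P\<in>\<F>. P a)" for \<F> :: "(('x \<Rightarrow> 'm) \<Rightarrow> bool) set" and a
  have "\<exists>i\<in>K. \<forall>a. S i a \<longrightarrow> all \<F> a" using \<open>finite \<F>\<close> \<open>\<F> \<subseteq> \<P>\<close>
  proof (induction \<F>)
    case empty
    then show ?case using ne by (auto simp: all_def)
  next
    case (insert P \<F>)
    then obtain i where i: "i \<in> K" "\<forall>a. S i a \<longrightarrow> all \<F> a" by blast
    obtain j where j: "j \<in> K" "\<forall>a. S j a \<longrightarrow> P a" using imp[of P] insert.prems by blast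
    obtain k where k: "k \<in> K" "\<forall>a. S k a \<longrightarrow> S i a \<and> S j a" using dir[OF i(1) j(1)] by blast
    have "all (insert P \<F>) a" if "S k a" for a
    proof -
      have "all \<F> a" "P a" using that i(2) j(2) k(2) by simp_all
      then show ?thesis by (simp add: all_def)
    qed
    then show ?case using k(1) by blast
  qed
  then obtain i a where "i \<in> K" "S i a" "all \<F> a" using sat by blast
  then show "\<exists>a. \<forall>P\<in>\<F>. P a" unfolding all_def by (intro exI[of _ a])
qed

section \<open>Types and their realizations\<close>

lemma holds_inst_right: "holds M a (inst_right b \<phi>) \<longleftrightarrow> sat M (case_sum a b) \<phi>"
proof -
  have "case_sum a id \<circ> map_sum id b = case_sum a b"
    by (auto simp: fun_eq_iff split: sum.split)
  then show ?thesis by (simp add: holds_def inst_right_def sat_map)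
qed

lemma holds_inst_left: "holds M b (inst_left a \<phi>) \<longleftrightarrow> sat M (case_sum a b) \<phi>"
proof -
  have "case_sum b id \<circ> case_sum (\<lambda>i. Inr (a i)) Inl = case_sum a b"
    by (auto simp: fun_eq_iff split: sum.split)
  then show ?thesis by (simp add: holds_def inst_left_def sat_map)
qed

lemma inst_right_in_fmlas:
  assumes "\<phi> \<in> fmlas L (X <+> Y)" and "b ` Y \<subseteq> C"
  shows "inst_right b \<phi> \<in> fmlas L (X <+> C)"
  unfolding inst_right_def by (rule map_fm_in_fmlas[OF assms(1)]) (use assms(2) in auto)

lemma tp_in_complete_types: "tp L M X a C \<in> complete_types L M X C"
  by (auto simp: complete_types_def partial_type_def tp_def consistent_def realizes_def)

lemma realized_complete_type:
  assumes "q \<in> complete_types L M X C" and "realizes M a q"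
  shows "q = tp L M X a C"
proof -
  have "q \<subseteq> fmlas L (X <+> C)" "\<And>\<phi>. \<phi> \<in> fmlas L (X <+> C) \<Longrightarrow> \<phi> \<in> q \<or> Neg \<phi> \<in> q"
    using assms(1) by (auto simp: complete_types_def partial_type_def)
  then show ?thesis using assms(2) unfolding tp_def realizes_def by (auto, fastforce)
qed

lemma complete_type_realized:
  assumes "monster_model L T \<kappa> M" and "|X| <o \<kappa>" and "|C| <o \<kappa>" and "q \<in> complete_types L M X C"
  obtains a where "q = tp L M X a C"
proof -
  have "q \<subseteq> fmlas L (X <+> C)" "consistent M q"
    using assms(4) by (auto simp: complete_types_def partial_type_def)
  then obtain a where "realizes M a q" using saturation[OF assms(1-3)] by blast
  then show ?thesis using that realized_complete_type[OF assms(4)] by blast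
qed

lemma realizes_restrict_tp:
  assumes "A \<subseteq> B" and "realizes M b (restrict_type L I (tp L M I a B) A)"
    and "\<phi> \<in> fmlas L (I <+> A)"
  shows "holds M b \<phi> \<longleftrightarrow> holds M a \<phi>"
proof -
  have "\<phi> \<in> fmlas L (I <+> B)" using assms(1,3) fmlas_mono[of "I <+> A" "I <+> B" L] by auto
  then have "(if holds M a \<phi> then \<phi> else Neg \<phi>) \<in> restrict_type L I (tp L M I a B) A"
    using assms(3) by (auto simp: restrict_type_def tp_def)
  then have "holds M b (if holds M a \<phi> then \<phi> else Neg \<phi>)"
    using assms(2) unfolding realizes_def by blast
  then show ?thesis by (simp split: if_splits)
qed

lemma definable_pure_formula:
  assumes "definable_over L M {} P" and "depends_only V P"
  obtains \<phi> where "\<phi> \<in> fmlas L V" and "\<And>v. sat M v \<phi> \<longleftrightarrow> P v"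
proof -
  obtain \<phi> where \<phi>: "\<phi> \<in> fmlas L (V <+> {})" "\<And>a. holds M a \<phi> \<longleftrightarrow> P a"
    using definable_formula[OF assms] by blast
  have "map_fm (case_sum id (\<lambda>_. undefined)) \<phi> \<in> fmlas L V"
    by (rule map_fm_in_fmlas[OF \<phi>(1)]) auto
  moreover have "sat M v (map_fm (case_sum id (\<lambda>_. undefined)) \<phi>) \<longleftrightarrow> P v" for v
  proof -
    have "sat M v (map_fm (case_sum id (\<lambda>_. undefined)) \<phi>) \<longleftrightarrow> holds M v \<phi>"
      unfolding sat_map holds_def by (rule sat_cong) (use \<phi>(1) in \<open>auto simp: fmlas_def split: sum.split\<close>)
    then show ?thesis using \<phi>(2) by simp
  qed
  ultimately show ?thesis by (rule that)
qed

section \<open>Transfer of configurations along types that do not co-divide\<close>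

text \<open>This is where co-dividing enters. Write \<open>\<Theta>(x, u)\<close> for the conjunction of \<open>F\<close> with the elements of
  \<open>B\<close> replaced by variables \<open>u\<close>. If the claim fails, then \<open>\<chi>(u, a)\<close>, saying that \<open>\<Theta>(a, u)\<close> holds and
  that no \<open>N\<close> solutions of \<open>\<Theta>(x, u)\<close> form a sequence with \<open>P\<close>, is true when \<open>u\<close> is \<open>B\<close>, hence follows
  from \<open>tp(B/aA)\<close>. It divides over \<open>A\<close>: a common solution \<open>u\<close> of \<open>\<chi>(u, \<alpha>\<^sub>i)\<close> for \<open>N\<close> indices \<open>i\<close> would
  make these \<open>\<alpha>\<^sub>i\<close> solutions of \<open>\<Theta>(x, u)\<close> that do have \<open>P\<close>.\<close>

lemma noncodividing_transfer_finite:
  fixes M :: "('f, 'r, 'm) struct" and I :: "'i set" and a :: "'i \<Rightarrow> 'm"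
    and \<alpha> :: "nat \<Rightarrow> 'i \<Rightarrow> 'm" and P :: "(nat \<times> 'i \<Rightarrow> 'm) \<Rightarrow> bool"
  assumes AB: "A \<subseteq> B" and nd: "\<not> divides L M B A (tp L M B id (a ` I \<union> A))"
    and \<alpha>: "\<And>i. realizes M (\<alpha> i) (restrict_type L I (tp L M I a B) A)"
    and def: "definable_over L M {} P"
    and her: "\<And>e. strict_mono_on {..<N} e \<Longrightarrow> P (\<lambda>(i, x). \<alpha> (e i) x)"
    and F: "finite F" "F \<subseteq> tp L M I a B"
  shows "\<exists>\<beta>. (\<forall>i<N. \<forall>\<theta>\<in>F. holds M (\<lambda>x. \<beta> (i, x)) \<theta>) \<and> P \<beta>"
proof (rule ccontr)
  assume contra: "\<not> ?thesis"
  define \<Theta> where "\<Theta> v \<longleftrightarrow> (\<forall>\<theta>\<in>F. sat M v \<theta>)" for v :: "'i + 'm \<Rightarrow> 'm"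
  define \<chi> where "\<chi> v \<longleftrightarrow> \<Theta> (case_sum (\<lambda>x. v (Inr x)) (\<lambda>c. v (Inl c))) \<and>
      \<not> (\<exists>\<beta>. (\<forall>i\<in>{..<N}. \<Theta> (case_sum (\<lambda>x. \<beta> (i, x)) (\<lambda>c. v (Inl c)))) \<and> P \<beta>)"
    for v :: "'m + 'i \<Rightarrow> 'm"
  have F': "\<theta> \<in> fmlas L (I <+> B)" if "\<theta> \<in> F" for \<theta> using F that by (auto simp: tp_def)
  have def\<Theta>: "definable_over L M {} \<Theta>"
    unfolding \<Theta>_def by (intro definable_Ball F(1)) (rule definable_sat[OF F'])
  have "definable_over L M {} (\<lambda>w :: ('m + 'i) + nat \<times> 'i \<Rightarrow> 'm.
      (\<forall>i\<in>{..<N}. \<Theta> (\<lambda>z. w (case_sum (\<lambda>x. Inr (i, x)) (\<lambda>c. Inl (Inl c)) z))) \<and> P (\<lambda>z. w (Inr z)))"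
    by (intro definable_and definable_Ball definable_rename[OF def\<Theta>] definable_rename[OF def]) simp
  note def1 = definable_ex[OF this]
  have eq1: "(\<lambda>z. case_sum v \<beta> (case_sum (\<lambda>x. Inr (i, x)) (\<lambda>c. Inl (Inl c)) z))
      = case_sum (\<lambda>x. \<beta> (i, x)) (\<lambda>c. v (Inl c))" for v :: "'m + 'i \<Rightarrow> 'm" and \<beta> and i :: nat
    by (auto simp: fun_eq_iff split: sum.split)
  have eq2: "(\<lambda>z. v (case_sum Inr Inl z)) = case_sum (\<lambda>x. v (Inr x)) (\<lambda>c. v (Inl c))"
    for v :: "'m + 'i \<Rightarrow> 'm"
    by (auto simp: fun_eq_iff split: sum.split)
  have def\<chi>: "definable_over L M {} \<chi>"
    using definable_and[OF definable_rename[OF def\<Theta>, where f = "case_sum Inr Inl"] definable_not[OF def1]]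
    unfolding eq1 eq2 by (simp add: \<chi>_def[abs_def])
  have dep\<Theta>: "\<Theta> v = \<Theta> w" if "\<forall>z\<in>I <+> B. v z = w z" for v w
  proof -
    have "sat M v \<theta> = sat M w \<theta>" if "\<theta> \<in> F" for \<theta>
      by (rule sat_cong) (use F'[OF that] \<open>\<forall>z\<in>I <+> B. v z = w z\<close> in \<open>auto simp: fmlas_def\<close>)
    then show ?thesis by (simp add: \<Theta>_def)
  qed
  have "depends_only (B <+> I) \<chi>"
    unfolding depends_only_def
  proof (intro allI impI)
    fix v w :: "'m + 'i \<Rightarrow> 'm" assume vw: "\<forall>z\<in>B <+> I. v z = w z"
    have "\<Theta> (case_sum (\<lambda>x. v (Inr x)) (\<lambda>c. v (Inl c))) = \<Theta> (case_sum (\<lambda>x. w (Inr x)) (\<lambda>c. w (Inl c)))"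
      by (rule dep\<Theta>) (use vw in auto)
    moreover have "\<Theta> (case_sum b (\<lambda>c. v (Inl c))) = \<Theta> (case_sum b (\<lambda>c. w (Inl c)))" for b
      by (rule dep\<Theta>) (use vw in auto)
    ultimately show "\<chi> v = \<chi> w" by (simp add: \<chi>_def)
  qed
  then obtain \<xi> where \<xi>: "\<xi> \<in> fmlas L (B <+> I)" "\<And>v. sat M v \<xi> \<longleftrightarrow> \<chi> v"
    using definable_pure_formula[OF def\<chi>] by blast
  \<comment> \<open>The definition of dividing asks for a finite tuple in place of \<open>a\<close>: only the coordinates in \<open>J\<close>
    occur in \<open>\<chi>\<close>, and \<open>h\<close> enumerates them.\<close>
  define J where "J = I \<inter> Inr -` fv \<xi>"
  have "finite J" using finite_fv[of \<xi>] by (simp add: J_def finite_vimageI)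
  then obtain h where h: "bij_betw h {..<card J} J"
    using ex_bij_betw_nat_finite[of J] by (auto simp: lessThan_atLeast0)
  define h' where "h' = inv_into {..<card J} h"
  have h': "h' x < card J" "h (h' x) = x" if "x \<in> J" for x
    using that h bij_betw_imp_surj_on[OF h] unfolding h'_def
    by (metis inv_into_into lessThan_iff, metis f_inv_into_f)
  have hI: "h i \<in> I" if "i < card J" for i using h that by (auto simp: bij_betw_def J_def)
  define \<psi> where "\<psi> = map_fm (map_sum id h') \<xi>"
  have "\<xi> \<in> fmlas L (B <+> J)" using \<xi>(1) by (auto simp: fmlas_def J_def)
  then have \<psi>: "\<psi> \<in> fmlas L (B <+> {..<card J})"
    unfolding \<psi>_def by (rule map_fm_in_fmlas) (use h' in auto)
  have holds_\<psi>: "holds M u (inst_right (b \<circ> h) \<psi>) \<longleftrightarrow> \<chi> (case_sum u b)" for u and b :: "'i \<Rightarrow> 'm"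
  proof -
    have "sat M (case_sum u (b \<circ> h) \<circ> map_sum id h') \<xi> \<longleftrightarrow> sat M (case_sum u b) \<xi>"
      by (rule sat_cong)
        (use \<open>\<xi> \<in> fmlas L (B <+> J)\<close> h' in \<open>auto simp: fmlas_def split: sum.split\<close>)
    then show ?thesis by (simp add: holds_inst_right \<psi>_def sat_map \<xi>(2))
  qed
  \<comment> \<open>For \<open>N = 0\<close> the family of \<open>N\<close> formulas would be empty and its consistency no contradiction.\<close>
  have "N > 0"
  proof (rule ccontr)
    assume "\<not> N > 0"
    then have "P (\<lambda>(i, x). \<alpha> i x)" using her[of id] by simp
    then show False using contra \<open>\<not> N > 0\<close> by auto
  qed
  have "formula_divides L M B A (inst_right (a \<circ> h) \<psi>)"
    unfolding formula_divides_def
  proof (intro exI conjI allI impI)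
    show "\<psi> \<in> fmlas L (B <+> {..<card J})" by (fact \<psi>)
    show "inst_right (a \<circ> h) \<psi> = inst_right (a \<circ> h) \<psi>" ..
    show "tp L M {..<card J} (\<alpha> i \<circ> h) A = tp L M {..<card J} (a \<circ> h) A" for i
    proof -
      have "holds M (\<alpha> i \<circ> h) \<delta> = holds M (a \<circ> h) \<delta>"
        if "\<delta> \<in> fmlas L ({..<card J} <+> A)" for \<delta>
      proof -
        have "map_fm (map_sum h id) \<delta> \<in> fmlas L (I <+> A)"
          by (rule map_fm_in_fmlas[OF that]) (use hI in auto)
        then have "holds M (\<alpha> i) (map_fm (map_sum h id) \<delta>) = holds M a (map_fm (map_sum h id) \<delta>)"
          by (rule realizes_restrict_tp[OF AB \<alpha>])
        moreover have "case_sum b id \<circ> map_sum h id = case_sum (b \<circ> h) id" for b :: "'i \<Rightarrow> 'm"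
          by (auto simp: fun_eq_iff split: sum.split)
        ultimately show ?thesis by (simp add: holds_def sat_map)
      qed
      then show ?thesis by (auto simp: tp_def)
    qed
    fix K :: "nat set" assume K: "finite K \<and> card K = N"
    then obtain e where e: "bij_betw e {..<N} K" "strict_mono_on {..<N} e"
      using ex_bij_betw_strict_mono_card[of K] by metis
    show "\<not> consistent M {inst_right (\<alpha> i \<circ> h) \<psi> |i. i \<in> K}"
    proof
      assume "consistent M {inst_right (\<alpha> i \<circ> h) \<psi> |i. i \<in> K}"
      moreover have "finite {inst_right (\<alpha> i \<circ> h) \<psi> |i. i \<in> K}" using K by simp
      ultimately obtain u where "realizes M u {inst_right (\<alpha> i \<circ> h) \<psi> |i. i \<in> K}"
        unfolding consistent_def by blast
      then have u: "\<chi> (case_sum u (\<alpha> i))" if "i \<in> K" for i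
        using that unfolding realizes_def by (auto simp: holds_\<psi>[symmetric])
      have eK: "e i \<in> K" if "i < N" for i using e(1) that by (auto simp: bij_betw_def)
      have "\<forall>i\<in>{..<N}. \<Theta> (case_sum (\<lambda>x. (\<lambda>(i, x). \<alpha> (e i) x) (i, x)) u)"
        using u[OF eK] by (auto simp: \<chi>_def)
      moreover have "P (\<lambda>(i, x). \<alpha> (e i) x)" by (rule her[OF e(2)])
      ultimately have "\<exists>\<beta>. (\<forall>i\<in>{..<N}. \<Theta> (case_sum (\<lambda>x. \<beta> (i, x)) u)) \<and> P \<beta>" by blast
      then show False using u[OF eK[OF \<open>N > 0\<close>]] by (simp add: \<chi>_def)
    qed
  qed
  moreover have "holds M u (inst_right (a \<circ> h) \<psi>)"
    if "realizes M u (tp L M B id (a ` I \<union> A))" for u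
  proof -
    have "\<Theta> (case_sum a id)" using F(2) by (auto simp: \<Theta>_def tp_def holds_def)
    moreover have "\<not> (\<exists>\<beta>. (\<forall>i\<in>{..<N}. \<Theta> (case_sum (\<lambda>x. \<beta> (i, x)) id)) \<and> P \<beta>)"
      using contra by (auto simp: \<Theta>_def holds_def)
    ultimately have "holds M id (inst_right (a \<circ> h) \<psi>)"
      by (simp add: holds_\<psi> \<chi>_def id_def)
    moreover have "inst_right (a \<circ> h) \<psi> \<in> fmlas L (B <+> (a ` I \<union> A))"
      by (rule inst_right_in_fmlas[OF \<psi>]) (use hI in auto)
    ultimately show ?thesis using that by (simp add: tp_def realizes_def)
  qed
  ultimately show False using nd unfolding divides_def by blast
qed

lemma sequence_compactness:
  fixes M :: "('f, 'r, 'm) struct" and I :: "'i set"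
    and P :: "nat \<Rightarrow> (nat \<times> 'i \<Rightarrow> 'm) \<Rightarrow> bool"
  assumes monster: "monster_model L T \<kappa> M" and I: "|I| <o \<kappa>" and C: "|C| <o \<kappa>"
    and \<pi>: "\<pi> \<subseteq> fmlas L (I <+> C)"
    and def: "\<And>N. definable_over L M {} (P N)" and dep: "\<And>N. depends_only (UNIV \<times> I) (P N)"
    and anti: "\<And>N N' v. N \<le> N' \<Longrightarrow> P N' v \<Longrightarrow> P N v"
    and fin: "\<And>F N. finite F \<Longrightarrow> F \<subseteq> \<pi> \<Longrightarrow>
      \<exists>\<beta>. (\<forall>i<N. \<forall>\<theta>\<in>F. holds M (\<lambda>x. \<beta> (i, x)) \<theta>) \<and> P N \<beta>"
  obtains \<beta> where "\<forall>i. realizes M (\<lambda>x. \<beta> (i, x)) \<pi>" and "\<forall>N. P N \<beta>"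
proof -
  define \<P> where "\<P> = {(\<lambda>\<beta>. holds M (\<lambda>x. \<beta> (i :: nat, x)) \<theta>) |i \<theta>. \<theta> \<in> \<pi>} \<union> range P"
  define S where "S = (\<lambda>(N, F) \<beta>. (\<forall>i<N. \<forall>\<theta>\<in>F. holds M (\<lambda>x. \<beta> (i, x)) \<theta>) \<and> P N \<beta>)"
  have \<P>_cases: thesis
    if "Q \<in> \<P>" and "\<And>i \<theta>. \<theta> \<in> \<pi> \<Longrightarrow> Q = (\<lambda>\<beta>. holds M (\<lambda>x. \<beta> (i, x)) \<theta>) \<Longrightarrow> thesis"
      and "\<And>N. Q = P N \<Longrightarrow> thesis" for Q thesis
    using that(1) unfolding \<P>_def by (elim UnE CollectE exE conjE rangeE) (erule that(2,3), assumption?)+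
  have small: "|(UNIV :: nat set) \<times> I| <o \<kappa>" by (rule small_Times_nat[OF monster I])
  obtain \<beta> where \<beta>: "\<forall>Q\<in>\<P>. Q \<beta>"
  proof (rule definable_saturation_directed[OF monster small C])
    fix Q assume Q: "Q \<in> \<P>"
    show "definable_over L M C Q"
    proof (rule \<P>_cases[OF Q])
      fix i \<theta> assume \<theta>: "\<theta> \<in> \<pi>" and Q: "Q = (\<lambda>\<beta>. holds M (\<lambda>x. \<beta> (i, x)) \<theta>)"
      have "\<theta> \<in> fmlas L (I <+> C)" using \<theta> \<pi> by blast
      then show ?thesis unfolding Q by (rule definable_rename[OF definable_holds, where f = "Pair i"])
    next
      fix N assume "Q = P N"
      then show ?thesis using definable_mono[OF def] by simp
    qed
    show "depends_only (UNIV \<times> I) Q"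
    proof (rule \<P>_cases[OF Q])
      fix i \<theta> assume \<theta>: "\<theta> \<in> \<pi>" and Q: "Q = (\<lambda>\<beta>. holds M (\<lambda>x. \<beta> (i, x)) \<theta>)"
      have "\<theta> \<in> fmlas L (I <+> C)" using \<theta> \<pi> by blast
      then show ?thesis
        unfolding Q depends_only_def by (intro allI impI) (rule holds_cong, assumption, simp)
    next
      fix N assume "Q = P N"
      then show ?thesis using dep by simp
    qed
    show "\<exists>k\<in>{(N, F). finite F \<and> F \<subseteq> \<pi>}. \<forall>\<beta>. S k \<beta> \<longrightarrow> Q \<beta>"
    proof (rule \<P>_cases[OF Q])
      fix i \<theta> assume "\<theta> \<in> \<pi>" "Q = (\<lambda>\<beta>. holds M (\<lambda>x. \<beta> (i, x)) \<theta>)"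
      then show ?thesis by (intro bexI[of _ "(Suc i, {\<theta>})"]) (simp_all add: S_def)
    next
      fix N assume "Q = P N"
      then show ?thesis by (intro bexI[of _ "(N, {})"]) (simp_all add: S_def)
    qed
  next
    show "{(N :: nat, F). finite F \<and> F \<subseteq> \<pi>} \<noteq> {}" by auto
    show "\<exists>\<beta>. S k \<beta>" if k: "k \<in> {(N, F). finite F \<and> F \<subseteq> \<pi>}" for k
    proof (cases k)
      case (Pair N F)
      then show ?thesis using k fin[of F N] by (simp add: S_def)
    qed
    fix k l assume kl: "k \<in> {(N :: nat, F). finite F \<and> F \<subseteq> \<pi>}" "l \<in> {(N :: nat, F). finite F \<and> F \<subseteq> \<pi>}"
    obtain N F N' F' where eq: "k = (N, F)" "l = (N', F')" by (cases k, cases l)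
    have "S k \<beta> \<and> S l \<beta>" if "S (max N N', F \<union> F') \<beta>" for \<beta>
    proof -
      have "P N \<beta>" "P N' \<beta>"
        using that anti[of N "max N N'" \<beta>] anti[of N' "max N N'" \<beta>] by (simp_all add: S_def)
      then show ?thesis using that by (simp add: S_def eq)
    qed
    then show "\<exists>m\<in>{(N, F). finite F \<and> F \<subseteq> \<pi>}. \<forall>\<beta>. S m \<beta> \<longrightarrow> S k \<beta> \<and> S l \<beta>"
      using kl eq by (intro bexI[of _ "(max N N', F \<union> F')"]) simp_all
  qed
  show ?thesis
  proof (rule that)
    show "\<forall>i. realizes M (\<lambda>x. \<beta> (i, x)) \<pi>"
      unfolding realizes_def
    proof (intro allI ballI)
      fix i \<theta> assume "\<theta> \<in> \<pi>"
      then have "(\<lambda>\<beta>. holds M (\<lambda>x. \<beta> (i, x)) \<theta>) \<in> \<P>" unfolding \<P>_def by blast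
      from \<beta>[rule_format, OF this] show "holds M (\<lambda>x. \<beta> (i, x)) \<theta>" .
    qed
    show "\<forall>N. P N \<beta>"
    proof
      fix N
      have "P N \<in> \<P>" by (simp add: \<P>_def)
      from \<beta>[rule_format, OF this] show "P N \<beta>" .
    qed
  qed
qed

section \<open>The independence property\<close>

definition shatters ::
  "('f, 'r, 'm) struct \<Rightarrow> ('f, 'r, 'i + nat) fm \<Rightarrow> nat \<Rightarrow> (nat \<times> 'i \<Rightarrow> 'm) \<Rightarrow> bool" where
  "shatters M \<phi> N \<alpha> \<longleftrightarrow>
     (\<forall>s\<in>Pow {..<N}. \<exists>b. \<forall>i\<in>{..<N}. sat M (case_sum (\<lambda>x. \<alpha> (i, x)) b) \<phi> \<longleftrightarrow> i \<in> s)"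

lemma definable_shatters:
  fixes M :: "('f, 'r, 'm) struct" and \<phi> :: "('f, 'r, 'i + nat) fm"
  assumes "\<phi> \<in> fmlas L V"
  shows "definable_over L M C (shatters M \<phi> N)"
proof -
  have row: "definable_over L M C (\<lambda>w :: nat \<times> 'i + nat \<Rightarrow> 'm. sat M (\<lambda>z. w (map_sum (Pair i) id z)) \<phi>)"
    for i
    by (rule definable_rename[OF definable_sat[OF assms], where f = "map_sum (Pair i) id"])
  have "definable_over L M C (\<lambda>w :: nat \<times> 'i + nat \<Rightarrow> 'm.
      \<forall>i\<in>{..<N}. sat M (\<lambda>z. w (map_sum (Pair i) id z)) \<phi> \<longleftrightarrow> i \<in> s)" for s
    by (intro definable_Ball definable_iff definable_const row) simp
  from definable_ex[OF this]
  have ex: "definable_over L M C (\<lambda>\<alpha>. \<exists>b. \<forall>i\<in>{..<N}.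
      sat M (\<lambda>z. case_sum \<alpha> b (map_sum (Pair i) id z)) \<phi> \<longleftrightarrow> i \<in> s)" for s .
  have eq: "(\<lambda>z. case_sum \<alpha> b (map_sum (Pair i) id z)) = case_sum (\<lambda>x. \<alpha> (i, x)) b"
    for \<alpha> :: "nat \<times> 'i \<Rightarrow> 'm" and b and i
    by (auto simp: fun_eq_iff split: sum.split)
  show ?thesis
    unfolding shatters_def by (intro definable_Ball) (use ex in \<open>simp_all only: eq finite_Pow_iff finite_lessThan\<close>)
qed

lemma depends_only_shatters:
  fixes M :: "('f, 'r, 'm) struct" and \<phi> :: "('f, 'r, 'i + nat) fm"
  assumes "\<phi> \<in> fmlas L (I <+> Y)"
  shows "depends_only (UNIV \<times> I) (shatters M \<phi> N)"
  unfolding depends_only_def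
proof (intro allI impI)
  fix \<alpha> \<beta> :: "nat \<times> 'i \<Rightarrow> 'm" assume "\<forall>z\<in>UNIV \<times> I. \<alpha> z = \<beta> z"
  then have "sat M (case_sum (\<lambda>x. \<alpha> (i, x)) b) \<phi> = sat M (case_sum (\<lambda>x. \<beta> (i, x)) b) \<phi>" for i b
    by (intro sat_cong) (use assms in \<open>auto simp: fmlas_def split: sum.split\<close>)
  then show "shatters M \<phi> N \<alpha> = shatters M \<phi> N \<beta>" by (simp add: shatters_def)
qed

lemma shatters_antimono: "N \<le> N' \<Longrightarrow> shatters M \<phi> N' \<alpha> \<Longrightarrow> shatters M \<phi> N \<alpha>"
  unfolding shatters_def
proof (intro ballI)
  fix s assume "N \<le> N'" "s \<in> Pow {..<N}"
    and sh: "\<forall>s\<in>Pow {..<N'}. \<exists>b. \<forall>i\<in>{..<N'}. sat M (case_sum (\<lambda>x. \<alpha> (i, x)) b) \<phi> \<longleftrightarrow> i \<in> s"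
  then have "s \<in> Pow {..<N'}" by auto
  then obtain b where "\<forall>i\<in>{..<N'}. sat M (case_sum (\<lambda>x. \<alpha> (i, x)) b) \<phi> \<longleftrightarrow> i \<in> s" using sh by blast
  then show "\<exists>b. \<forall>i\<in>{..<N}. sat M (case_sum (\<lambda>x. \<alpha> (i, x)) b) \<phi> \<longleftrightarrow> i \<in> s"
    using \<open>N \<le> N'\<close> by (intro exI[of _ b]) auto
qed

text \<open>The hypotheses on \<open>P\<close> fit half graphs and shattered sequences: both properties are first-order,
  weaken as \<open>N\<close> decreases, and pass to subsequences.\<close>

lemma noncodividing_transfer:
  fixes M :: "('f, 'r, 'm) struct" and I :: "'i set" and a :: "'i \<Rightarrow> 'm"
    and \<alpha> :: "nat \<Rightarrow> 'i \<Rightarrow> 'm" and P :: "nat \<Rightarrow> (nat \<times> 'i \<Rightarrow> 'm) \<Rightarrow> bool"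
  assumes monster: "monster_model L T \<kappa> M" and I: "|I| <o \<kappa>" and B: "|B| <o \<kappa>" and AB: "A \<subseteq> B"
    and p: "p \<in> complete_types L M I B" and nc: "\<not> codivides L M I A B p"
    and \<alpha>: "\<And>i. realizes M (\<alpha> i) (restrict_type L I p A)"
    and def: "\<And>N. definable_over L M {} (P N)" and dep: "\<And>N. depends_only (UNIV \<times> I) (P N)"
    and anti: "\<And>N N' v. N \<le> N' \<Longrightarrow> P N' v \<Longrightarrow> P N v"
    and her: "\<And>N e. strict_mono_on {..<N} e \<Longrightarrow> P N (\<lambda>(i, x). \<alpha> (e i) x)"
  obtains \<beta> where "\<forall>i. realizes M (\<lambda>x. \<beta> (i, x)) p" and "\<forall>N. P N \<beta>"
proof -
  obtain a where a: "p = tp L M I a B" by (rule complete_type_realized[OF monster I B p])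
  have nd: "\<not> divides L M B A (tp L M B id (a ` I \<union> A))" using nc a by (auto simp: codivides_def)
  have "p \<subseteq> fmlas L (I <+> B)" using a by (auto simp: tp_def)
  then show ?thesis
  proof (rule sequence_compactness[where P = P, OF monster I B _ def dep])
    show "P N v" if "N \<le> N'" "P N' v" for N N' v by (rule anti[OF that])
    fix F N assume "finite F" "F \<subseteq> p"
    then show "\<exists>\<beta>. (\<forall>i<N. \<forall>\<theta>\<in>F. holds M (\<lambda>x. \<beta> (i, x)) \<theta>) \<and> P N \<beta>"
      using \<alpha> her unfolding a by (intro noncodividing_transfer_finite[OF AB nd _ def])
  qed (rule that)
qed

lemma has_IP_transfer:
  fixes M :: "('f, 'r, 'm) struct" and I :: "'i set"
  assumes monster: "monster_model L T \<kappa> M" and I: "|I| <o \<kappa>" and B: "|B| <o \<kappa>" and AB: "A \<subseteq> B"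
    and p: "p \<in> complete_types L M I B" and nc: "\<not> codivides L M I A B p"
    and IP: "has_IP L M I (restrict_type L I p A)"
  shows "has_IP L M I p"
proof -
  obtain n \<phi> and \<alpha> :: "nat \<Rightarrow> 'i \<Rightarrow> 'm" where \<phi>: "\<phi> \<in> fmlas L (I <+> {..<n::nat})"
    and \<alpha>: "\<And>i. realizes M (\<alpha> i) (restrict_type L I p A)"
    and cons: "\<And>s. consistent M {signed (i \<in> s) (inst_left (\<alpha> i) \<phi>) |i. True}"
    using IP unfolding has_IP_def by blast
  have her: "shatters M \<phi> N (\<lambda>(i, x). \<alpha> (e i) x)" if e: "strict_mono_on {..<N} e" for N e
    unfolding shatters_def
  proof
    fix s assume s: "s \<in> Pow {..<N}"
    have inj: "inj_on e {..<N}" using e by (rule strict_mono_on_imp_inj_on)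
    \<comment> \<open>A subset \<open>s\<close> of the positions in the subsequence is the trace of the subset \<open>e ` s\<close> of \<open>\<omega>\<close>.\<close>
    let ?F = "(\<lambda>i. signed (e i \<in> e ` s) (inst_left (\<alpha> (e i)) \<phi>)) ` {..<N}"
    have "finite ?F" "?F \<subseteq> {signed (i \<in> e ` s) (inst_left (\<alpha> i) \<phi>) |i. True}" by auto
    then obtain b where b: "realizes M b ?F" using cons[of "e ` s"] unfolding consistent_def by meson
    have "sat M (case_sum (\<alpha> (e i)) b) \<phi> \<longleftrightarrow> i \<in> s" if "i < N" for i
    proof -
      have "e i \<in> e ` s \<longleftrightarrow> i \<in> s" using inj that s by (auto simp: inj_on_def)
      moreover have "holds M b (signed (e i \<in> e ` s) (inst_left (\<alpha> (e i)) \<phi>))"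
        using b that by (auto simp: realizes_def)
      ultimately show ?thesis by (auto simp: signed_def holds_inst_left split: if_splits)
    qed
    then show "\<exists>b. \<forall>i\<in>{..<N}. sat M (case_sum (\<lambda>x. (\<lambda>(i, x). \<alpha> (e i) x) (i, x)) b) \<phi> \<longleftrightarrow> i \<in> s"
      by auto
  qed
  obtain \<beta> where \<beta>: "\<forall>i. realizes M (\<lambda>x. \<beta> (i, x)) p" and sh: "\<forall>N. shatters M \<phi> N \<beta>"
    by (rule noncodividing_transfer[where P = "shatters M \<phi>", OF monster I B AB p nc \<alpha> definable_shatters[OF \<phi>]
          depends_only_shatters[OF \<phi>] shatters_antimono her])
  have "consistent M {signed (i \<in> s) (inst_left (\<lambda>x. \<beta> (i, x)) \<phi>) |i. True}" for s
    unfolding consistent_def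
  proof (intro allI impI)
    fix F assume F: "finite F \<and> F \<subseteq> {signed (i \<in> s) (inst_left (\<lambda>x. \<beta> (i, x)) \<phi>) |i. True}"
    then have "F \<subseteq> range (\<lambda>i. signed (i \<in> s) (inst_left (\<lambda>x. \<beta> (i, x)) \<phi>))" by auto
    then obtain J where J: "finite J" "F = (\<lambda>i. signed (i \<in> s) (inst_left (\<lambda>x. \<beta> (i, x)) \<phi>)) ` J"
      using F finite_subset_image by (metis (no_types, lifting))
    then obtain N where N: "J \<subseteq> {..<N}" using finite_nat_bounded by blast
    have "s \<inter> {..<N} \<in> Pow {..<N}" by blast
    then obtain b where "\<forall>i\<in>{..<N}. sat M (case_sum (\<lambda>x. \<beta> (i, x)) b) \<phi> \<longleftrightarrow> i \<in> s \<inter> {..<N}"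
      using sh unfolding shatters_def by blast
    then have "realizes M b F" using N J(2) by (auto simp: realizes_def signed_def holds_inst_left)
    then show "\<exists>b. realizes M b F" by blast
  qed
  then show ?thesis
    unfolding has_IP_def using \<phi> \<beta> by (intro exI[of _ n] exI[of _ \<phi>] exI[of _ "\<lambda>i x. \<beta> (i, x)"]) auto
qed

section \<open>Binary trees and half graphs of a relation\<close>

text \<open>For \<open>R\<close> given by a formula \<open>\<phi>(x, y)\<close>, \<open>X\<close> a definable set and \<open>Y\<close> everything, this is the condition
  \<open>R\<^sub>\<phi>(X) \<ge> n\<close> for Shelah's local 2-rank. Unfolded, it asks for a full binary tree of height \<open>n\<close> with
  nodes labelled from \<open>Y\<close>, each of whose branches is taken by some \<open>a \<in> X\<close> that turns at a node \<open>b\<close>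
  according to \<open>R a b\<close>. Restricting the labels to \<open>Y\<close> is what makes the colouring arguments possible.\<close>

primrec branching :: "('a \<Rightarrow> 'b \<Rightarrow> bool) \<Rightarrow> nat \<Rightarrow> 'a set \<Rightarrow> 'b set \<Rightarrow> bool" where
  "branching R 0 X Y \<longleftrightarrow> X \<noteq> {}"
| "branching R (Suc n) X Y \<longleftrightarrow>
     (\<exists>b\<in>Y. branching R n {a \<in> X. R a b} Y \<and> branching R n {a \<in> X. \<not> R a b} Y)"

lemma branching_mono:
  assumes "branching R n X Y" and "X \<subseteq> X'" and "Y \<subseteq> Y'"
  shows "branching R n X' Y'"
  using assms
proof (induction n arbitrary: X X')
  case (Suc n)
  then obtain b where b: "b \<in> Y" "branching R n {a \<in> X. R a b} Y" "branching R n {a \<in> X. \<not> R a b} Y"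
    by auto
  have "branching R n {a \<in> X'. R a b} Y'" by (rule Suc.IH[OF b(2)]) (use Suc.prems in auto)
  moreover have "branching R n {a \<in> X'. \<not> R a b} Y'" by (rule Suc.IH[OF b(3)]) (use Suc.prems in auto)
  ultimately show ?case using b(1) Suc.prems by auto
qed auto

lemma branching_nonempty: "branching R n X Y \<Longrightarrow> X \<noteq> {}"
  by (induction n arbitrary: X) fastforce+

lemma branching_antimono: "branching R n X Y \<Longrightarrow> m \<le> n \<Longrightarrow> branching R m X Y"
proof (induction n arbitrary: m X)
  case (Suc n)
  show ?case
  proof (cases m)
    case 0
    then show ?thesis using branching_nonempty[OF Suc.prems(1)] by simp
  next
    case (Suc k)
    then show ?thesis using Suc.prems Suc.IH by fastforce
  qed
qed simp

text \<open>Colour the nodes of a tree with two colours. If the root has the first colour and neither of the two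
  subtrees below it already contains a tree of height \<open>n\<close> in the second, then both contain trees of
  height \<open>m - 1\<close> in the first, and the root joins them.\<close>

lemma branching_Un:
  assumes "branching R (m + n) X (Y \<union> Z)"
  shows "branching R m X Y \<or> branching R n X Z"
  using assms
proof (induction "m + n" arbitrary: m n X)
  case 0
  then show ?case by simp
next
  case (Suc k)
  then have br: "branching R (Suc k) X (Y \<union> Z)" by simp
  show ?case
  proof (cases "m = 0 \<or> n = 0")
    case True
    then show ?thesis using branching_nonempty[OF br] by auto
  next
    case False
    then obtain m' n' where mn: "m = Suc m'" "n = Suc n'" using not0_implies_Suc by blast
    obtain b where b: "b \<in> Y \<union> Z" "branching R k {a \<in> X. R a b} (Y \<union> Z)"
      "branching R k {a \<in> X. \<not> R a b} (Y \<union> Z)" using br by auto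
    have k: "k = m' + n" "k = m + n'" using Suc.hyps(2) mn by auto
    have sub: "{a \<in> X. R a b} \<subseteq> X" "{a \<in> X. \<not> R a b} \<subseteq> X" by auto
    show ?thesis
    proof (cases "b \<in> Y")
      case True
      have "branching R m' {a \<in> X. R a b} Y \<or> branching R n {a \<in> X. R a b} Z"
        "branching R m' {a \<in> X. \<not> R a b} Y \<or> branching R n {a \<in> X. \<not> R a b} Z"
        using Suc.hyps(1)[OF k(1)] b(2,3) k(1) by blast+
      then show ?thesis using True mn(1) branching_mono[of R n _ Z X Z] sub by auto
    next
      case False
      then have "b \<in> Z" using b(1) by blast
      have "branching R m {a \<in> X. R a b} Y \<or> branching R n' {a \<in> X. R a b} Z"
        "branching R m {a \<in> X. \<not> R a b} Y \<or> branching R n' {a \<in> X. \<not> R a b} Z"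
        using Suc.hyps(1)[OF k(2)] b(2,3) k(2) by blast+
      then show ?thesis using \<open>b \<in> Z\<close> mn(2) branching_mono[of R m _ Y X Y] sub by auto
    qed
  qed
qed

text \<open>A half graph, the finite form of the order property.\<close>

definition ladder :: "('a \<Rightarrow> 'b \<Rightarrow> bool) \<Rightarrow> nat \<Rightarrow> 'a set \<Rightarrow> 'b set \<Rightarrow> bool" where
  "ladder R n X Y \<longleftrightarrow> (\<exists>a b. (\<forall>i<n. a i \<in> X \<and> b i \<in> Y) \<and> (\<forall>i<n. \<forall>j<n. R (a i) (b j) \<longleftrightarrow> i \<le> j))"

lemma ladder_Suc:
  assumes "a \<in> X" and "b \<in> Y" and "R a b" and "ladder R n {a' \<in> X. \<not> R a' b} {b' \<in> Y. R a b'}"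
  shows "ladder R (Suc n) X Y"
proof -
  obtain f g where fg: "\<forall>i<n. f i \<in> {a' \<in> X. \<not> R a' b} \<and> g i \<in> {b' \<in> Y. R a b'}"
    "\<forall>i<n. \<forall>j<n. R (f i) (g j) \<longleftrightarrow> i \<le> j"
    using assms(4) unfolding ladder_def by (elim exE conjE) (rule that)
  have "case_nat a f i \<in> X \<and> case_nat b g i \<in> Y" if "i < Suc n" for i
    using that assms(1,2) fg(1) by (cases i) auto
  moreover have "R (case_nat a f i) (case_nat b g j) \<longleftrightarrow> i \<le> j" if "i < Suc n" "j < Suc n" for i j
  proof (cases i)
    case 0
    then show ?thesis using that assms(3) fg(1) by (cases j) auto
  next
    case (Suc i')
    then show ?thesis using that fg by (cases j) auto
  qed
  ultimately show ?thesis
    unfolding ladder_def by (intro exI[of _ "case_nat a f"] exI[of _ "case_nat b g"]) blast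
qed

lemma ladder_mono: "ladder R n X Y \<Longrightarrow> X \<subseteq> X' \<Longrightarrow> Y \<subseteq> Y' \<Longrightarrow> ladder R n X' Y'"
  unfolding ladder_def by (elim exE, rule exI, rule exI) auto

text \<open>Hodges' argument. Take any \<open>a \<in> X\<close> and colour the nodes \<open>b\<close> by \<open>R a b\<close>. In a high monochromatic
  subtree, keep the root \<open>b\<close> and continue on the side of \<open>b\<close> to which \<open>a\<close> does not belong. There \<open>a\<close>
  and \<open>b\<close> are related in one and the same way to everything that remains, so the pair becomes an end
  of the half graph found later: of one for \<open>R\<close> or of one for the negation of \<open>R\<close>, depending on
  the colour.\<close>

lemma branching_imp_ladder_or_neg:
  "\<exists>N. \<forall>X Y. branching R N X Y \<longrightarrow> ladder R l X Y \<or> ladder (\<lambda>a b. \<not> R a b) r X Y"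
proof (induction "l + r" arbitrary: l r)
  case 0
  then show ?case by (auto simp: ladder_def)
next
  case (Suc s)
  show ?case
  proof (cases "l = 0 \<or> r = 0")
    case True
    then show ?thesis by (auto simp: ladder_def)
  next
    case False
    then obtain l' r' where lr: "l = Suc l'" "r = Suc r'" using not0_implies_Suc by blast
    have "s = l' + r" "s = l + r'" using Suc.hyps(2) lr by auto
    from Suc.hyps(1)[OF this(1)] Suc.hyps(1)[OF this(2)] obtain N1 N2
      where N1: "\<forall>X Y. branching R N1 X Y \<longrightarrow> ladder R l' X Y \<or> ladder (\<lambda>a b. \<not> R a b) r X Y"
        and N2: "\<forall>X Y. branching R N2 X Y \<longrightarrow> ladder R l X Y \<or> ladder (\<lambda>a b. \<not> R a b) r' X Y"
      by (elim exE) (rule that)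
    show ?thesis
    proof (intro exI[of _ "Suc N1 + Suc N2"] allI impI)
      fix X Y assume br: "branching R (Suc N1 + Suc N2) X Y"
      obtain a where a: "a \<in> X" using branching_nonempty[OF br] by blast
      have "{b \<in> Y. R a b} \<union> {b \<in> Y. \<not> R a b} = Y" by auto
      then have "branching R (Suc N1) X {b \<in> Y. R a b} \<or> branching R (Suc N2) X {b \<in> Y. \<not> R a b}"
        using br by (intro branching_Un) simp
      then show "ladder R l X Y \<or> ladder (\<lambda>a b. \<not> R a b) r X Y"
      proof
        assume "branching R (Suc N1) X {b \<in> Y. R a b}"
        then obtain b where b: "b \<in> Y" "R a b" "branching R N1 {a' \<in> X. \<not> R a' b} {b \<in> Y. R a b}"
          by auto
        from N1[rule_format, OF b(3)] show ?thesis
        proof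
          assume "ladder R l' {a' \<in> X. \<not> R a' b} {b \<in> Y. R a b}"
          then show ?thesis using ladder_Suc[OF a b(1), where R = R] b(2) lr(1) by simp
        next
          assume "ladder (\<lambda>a b. \<not> R a b) r {a' \<in> X. \<not> R a' b} {b \<in> Y. R a b}"
          then show ?thesis using ladder_mono[of "\<lambda>a b. \<not> R a b" r _ _ X Y] by blast
        qed
      next
        assume "branching R (Suc N2) X {b \<in> Y. \<not> R a b}"
        then obtain b where b: "b \<in> Y" "\<not> R a b" "branching R N2 {a' \<in> X. R a' b} {b \<in> Y. \<not> R a b}"
          by auto
        from N2[rule_format, OF b(3)] show ?thesis
        proof
          assume "ladder (\<lambda>a b. \<not> R a b) r' {a' \<in> X. R a' b} {b \<in> Y. \<not> R a b}"
          then show ?thesis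
            using ladder_Suc[OF a b(1), where R = "\<lambda>a b. \<not> R a b"] b(2) lr(2) by simp
        next
          assume "ladder R l {a' \<in> X. R a' b} {b \<in> Y. \<not> R a b}"
          then show ?thesis using ladder_mono[of R l _ _ X Y] by blast
        qed
      qed
    qed
  qed
qed

text \<open>Reading a half graph for the negation of \<open>R\<close> backwards gives one for \<open>R\<close>. The diagonal has to move
  from one side to the other, which costs one rung.\<close>

lemma ladder_neg:
  assumes "ladder (\<lambda>a b. \<not> R a b) (Suc n) X Y"
  shows "ladder R n X Y"
proof -
  obtain a b where ab: "\<forall>i<Suc n. a i \<in> X \<and> b i \<in> Y"
    "\<forall>i<Suc n. \<forall>j<Suc n. (\<not> R (a i) (b j)) \<longleftrightarrow> i \<le> j"
    using assms unfolding ladder_def by (elim exE conjE) (rule that)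
  show ?thesis
    unfolding ladder_def
  proof (intro exI conjI allI impI)
    show "a (n - i) \<in> X" "b (n - Suc i) \<in> Y" if "i < n" for i using ab(1) that by auto
    show "R (a (n - i)) (b (n - Suc j)) \<longleftrightarrow> i \<le> j" if "i < n" "j < n" for i j
    proof -
      have "n - i < Suc n" "n - Suc j < Suc n" "n - i \<le> n - Suc j \<longleftrightarrow> \<not> i \<le> j"
        using that by auto
      then show ?thesis using ab(2) by metis
    qed
  qed
qed

lemma branching_imp_ladder: "\<exists>N. \<forall>X Y. branching R N X Y \<longrightarrow> ladder R n X Y"
proof -
  obtain N where "\<forall>X Y. branching R N X Y \<longrightarrow> ladder R n X Y \<or> ladder (\<lambda>a b. \<not> R a b) (Suc n) X Y"
    using branching_imp_ladder_or_neg[of R n "Suc n"] by (elim exE) (rule that)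
  then have "ladder R n X Y" if "branching R N X Y" for X Y
    using that ladder_neg[of R n X Y] by metis
  then show ?thesis by (intro exI[of _ N]) simp
qed

text \<open>Bisection: the middle rung splits a half graph into two of half the length.\<close>

lemma ladder_imp_branching:
  assumes "ladder R (2 ^ n) X Y"
  shows "branching R n X Y"
proof -
  obtain a b where "\<forall>i<(2::nat) ^ n. a i \<in> X \<and> b i \<in> Y" "\<forall>i<(2::nat) ^ n. \<forall>j<2 ^ n. R (a i) (b j) \<longleftrightarrow> i \<le> j"
    using assms unfolding ladder_def by (elim exE conjE) (rule that)
  moreover have "branching R n X Y"
    if "\<forall>i\<in>{m..<m + 2 ^ n}. a i \<in> X \<and> b i \<in> Y"
      and "\<forall>i\<in>{m..<m + 2 ^ n}. \<forall>j\<in>{m..<m + 2 ^ n}. R (a i) (b j) \<longleftrightarrow> i \<le> j" for m X n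
    using that
  proof (induction n arbitrary: m X)
    case 0
    then have "a m \<in> X" by simp
    then show ?case by auto
  next
    case (Suc n)
    \<comment> \<open>The last rung of the lower half: \<open>R (a i) (b k)\<close> holds for \<open>i\<close> in that half only.\<close>
    define k where "k = m + 2 ^ n - 1"
    have "(2 :: nat) ^ n > 0" by simp
    then have Suc_k: "Suc k = m + 2 ^ n" by (simp add: k_def)
    have le_k: "i \<le> k \<longleftrightarrow> i < m + 2 ^ n" for i unfolding Suc_k[symmetric] by auto
    have "m \<le> k" "k < m + 2 ^ n + 2 ^ n" using Suc_k \<open>(2 :: nat) ^ n > 0\<close> by linarith+
    then have k: "k \<in> {m..<m + 2 ^ Suc n}" by simp
    have sub: "{m..<m + 2 ^ n} \<subseteq> {m..<m + 2 ^ Suc n}"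
      "{m + 2 ^ n..<m + 2 ^ n + 2 ^ n} \<subseteq> {m..<m + 2 ^ Suc n}" by auto
    have R: "R (a i) (b k) \<longleftrightarrow> i < m + 2 ^ n" if "i \<in> {m..<m + 2 ^ Suc n}" for i
      using Suc.prems(2) that k le_k by blast
    have "branching R n {a \<in> X. R a (b k)} Y"
    proof (rule Suc.IH)
      show "\<forall>i\<in>{m..<m + 2 ^ n}. a i \<in> {a \<in> X. R a (b k)} \<and> b i \<in> Y"
        using Suc.prems(1) R sub(1) by auto
      show "\<forall>i\<in>{m..<m + 2 ^ n}. \<forall>j\<in>{m..<m + 2 ^ n}. R (a i) (b j) \<longleftrightarrow> i \<le> j"
        using Suc.prems(2) sub(1) by blast
    qed
    moreover have "branching R n {a \<in> X. \<not> R a (b k)} Y"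
    proof (rule Suc.IH)
      show "\<forall>i\<in>{m + 2 ^ n..<m + 2 ^ n + 2 ^ n}. a i \<in> {a \<in> X. \<not> R a (b k)} \<and> b i \<in> Y"
        using Suc.prems(1) R sub(2) by auto
      show "\<forall>i\<in>{m + 2 ^ n..<m + 2 ^ n + 2 ^ n}. \<forall>j\<in>{m + 2 ^ n..<m + 2 ^ n + 2 ^ n}. R (a i) (b j) \<longleftrightarrow> i \<le> j"
        using Suc.prems(2) sub(2) by blast
    qed
    moreover have "b k \<in> Y" using Suc.prems(1) k by blast
    ultimately show ?case by auto
  qed
  from this[where m = 0 and n = n and X = X] show ?thesis using calculation by auto
qed

text \<open>Repeated colouring by finitely many predicates. The tree property survives for all heights at
  once: a failure at height \<open>m\<close> in one colour and at height \<open>n\<close> in the other would contradict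
  \<open>branching_Un\<close> at height \<open>m + n\<close>.\<close>

lemma branching_homogeneous:
  assumes "finite \<Delta>" and "\<And>N. branching R N X Y"
  obtains Y' where "Y' \<subseteq> Y" and "\<forall>N. branching R N X Y'"
    and "\<forall>\<delta>\<in>\<Delta>. \<forall>b\<in>Y'. \<forall>c\<in>Y'. \<delta> b \<longleftrightarrow> \<delta> c"
proof -
  have "\<exists>Y'\<subseteq>Y. (\<forall>N. branching R N X Y') \<and> (\<forall>\<delta>\<in>\<Delta>. \<forall>b\<in>Y'. \<forall>c\<in>Y'. \<delta> b \<longleftrightarrow> \<delta> c)"
    using assms(1)
  proof (induction \<Delta>)
    case empty
    then show ?case using assms(2) by blast
  next
    case (insert \<delta> \<Delta>)
    from insert.IH obtain Y' where Y': "Y' \<subseteq> Y" "\<forall>N. branching R N X Y'"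
      "\<forall>\<delta>\<in>\<Delta>. \<forall>b\<in>Y'. \<forall>c\<in>Y'. \<delta> b \<longleftrightarrow> \<delta> c" by (elim exE conjE) (rule that)
    have "{b \<in> Y'. \<delta> b} \<union> {b \<in> Y'. \<not> \<delta> b} = Y'" by auto
    then have split: "branching R m X {b \<in> Y'. \<delta> b} \<or> branching R n X {b \<in> Y'. \<not> \<delta> b}" for m n
      using Y'(2) by (intro branching_Un) simp
    have "(\<forall>N. branching R N X {b \<in> Y'. \<delta> b}) \<or> (\<forall>N. branching R N X {b \<in> Y'. \<not> \<delta> b})"
      using split by blast
    then show ?case
    proof
      assume "\<forall>N. branching R N X {b \<in> Y'. \<delta> b}"
      then show ?thesis using Y' by (intro exI[of _ "{b \<in> Y'. \<delta> b}"]) auto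
    next
      assume "\<forall>N. branching R N X {b \<in> Y'. \<not> \<delta> b}"
      then show ?thesis using Y' by (intro exI[of _ "{b \<in> Y'. \<not> \<delta> b}"]) auto
    qed
  qed
  then show ?thesis by (elim exE conjE) (rule that)
qed

section \<open>Definability of the rank and of types of finite rank\<close>

text \<open>Each level of the tree adds one tuple of parameters. To keep a single type of parameter tuples
  throughout the induction, the tuple \<open>c\<close> of parameters of \<open>Q\<close> and the new one are merged into one
  sequence by \<open>sum_encode\<close>.\<close>

lemma definable_branching:
  fixes M :: "('f, 'r, 'm) struct" and R Q :: "('i \<Rightarrow> 'm) \<Rightarrow> (nat \<Rightarrow> 'm) \<Rightarrow> bool"
  assumes R: "definable_over L M C (\<lambda>w. R (\<lambda>x. w (Inl x)) (\<lambda>j. w (Inr j)))"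
    and Q: "definable_over L M C (\<lambda>w. Q (\<lambda>x. w (Inl x)) (\<lambda>j. w (Inr j)))"
  shows "definable_over L M C (\<lambda>c. branching R N {a. Q a c} UNIV)"
  using Q
proof (induction N arbitrary: Q)
  case 0
  from definable_ex[OF definable_rename[OF 0, where f = "case_sum Inr Inl"]]
  show ?case by simp
next
  case (Suc N)
  let ?l = "\<lambda>j. sum_encode (Inl j)" and ?r = "\<lambda>j. sum_encode (Inr j)"
  have Q': "definable_over L M C (\<lambda>w. Q (\<lambda>x. w (Inl x)) (\<lambda>j. w (Inr (?l j))))"
    using definable_rename[OF Suc.prems, where f = "map_sum id ?l"] by simp
  have R': "definable_over L M C (\<lambda>w. R (\<lambda>x. w (Inl x)) (\<lambda>j. w (Inr (?r j))))"
    using definable_rename[OF R, where f = "map_sum id ?r"] by simp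
  have pos: "definable_over L M C
      (\<lambda>c. branching R N {a. Q a (\<lambda>j. c (?l j)) \<and> R a (\<lambda>j. c (?r j))} UNIV)"
    by (rule Suc.IH[of "\<lambda>a c. Q a (\<lambda>j. c (?l j)) \<and> R a (\<lambda>j. c (?r j))", OF definable_and[OF Q' R']])
  have neg: "definable_over L M C
      (\<lambda>c. branching R N {a. Q a (\<lambda>j. c (?l j)) \<and> \<not> R a (\<lambda>j. c (?r j))} UNIV)"
    by (rule Suc.IH[of "\<lambda>a c. Q a (\<lambda>j. c (?l j)) \<and> \<not> R a (\<lambda>j. c (?r j))",
          OF definable_and[OF Q' definable_not[OF R']]])
  from definable_ex[OF definable_rename[OF definable_and[OF pos neg], where f = sum_decode]]
  show ?case by simp
qed

definition branches_infinitely ::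
  "('f, 'r, 'm) struct \<Rightarrow> ('f, 'r, 'i + nat) fm \<Rightarrow> ('f, 'r, 'i + 'm) fm set \<Rightarrow> bool" where
  "branches_infinitely M \<phi> \<pi> \<longleftrightarrow> (\<forall>F N. finite F \<and> F \<subseteq> \<pi> \<longrightarrow>
     branching (\<lambda>a b. sat M (case_sum a b) \<phi>) N {a. realizes M a F} UNIV)"

lemma branches_infinitelyD:
  "branches_infinitely M \<phi> \<pi> \<Longrightarrow> finite F \<Longrightarrow> F \<subseteq> \<pi> \<Longrightarrow>
     branching (\<lambda>a b. sat M (case_sum a b) \<phi>) N {a. realizes M a F} UNIV"
  by (simp add: branches_infinitely_def)

lemma branches_infinitely_subset:
  "branches_infinitely M \<phi> \<pi> \<Longrightarrow> \<rho> \<subseteq> \<pi> \<Longrightarrow> branches_infinitely M \<phi> \<rho>"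
  unfolding branches_infinitely_def by (meson subset_trans)

lemma definable_relation:
  fixes M :: "('f, 'r, 'm) struct" and \<phi> :: "('f, 'r, 'i + nat) fm"
  assumes "\<phi> \<in> fmlas L V"
  shows "definable_over L M C (\<lambda>w. sat M (case_sum (\<lambda>x. w (Inl x)) (\<lambda>j. w (Inr j))) \<phi>)"
proof -
  have "case_sum (\<lambda>x. w (Inl x)) (\<lambda>j. w (Inr j)) = w" for w :: "'i + nat \<Rightarrow> 'm"
    by (auto simp: fun_eq_iff split: sum.split)
  then show ?thesis using definable_sat[OF assms] by simp
qed

lemma definable_realizes:
  assumes "finite F" and "F \<subseteq> fmlas L (X <+> C)"
  shows "definable_over L M C (\<lambda>a. realizes M a F)"
  unfolding realizes_def using assms by (intro definable_Ball) (auto intro: definable_holds)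

text \<open>Among the finite subsets of \<open>q\<close> let \<open>F\<close> have the least rank \<open>m\<close>. Then \<open>\<phi>(x, c) \<in> q\<close> exactly if
  \<open>F \<union> {\<phi>(x, c)}\<close> still has rank \<open>m\<close>: if \<open>\<phi>(x, c) \<notin> q\<close>, then \<open>F \<union> {\<not> \<phi>(x, c)}\<close> has rank at least \<open>m\<close>
  by minimality, and if both had, then \<open>F\<close> would have rank \<open>m + 1\<close>. The parameters of this definition
  are those of \<open>F\<close>, hence in \<open>C\<close>.\<close>

lemma not_branching_imp_defining_formula:
  fixes M :: "('f, 'r, 'm) struct" and a :: "'i \<Rightarrow> 'm"
  assumes \<phi>: "\<phi> \<in> fmlas L (I <+> {..<n::nat})" and q: "q = tp L M I a C"
    and fin: "\<not> branches_infinitely M \<phi> q"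
  shows "\<exists>\<delta>\<in>fmlas L ({..<n} <+> C). \<forall>c. c ` {..<n} \<subseteq> C \<longrightarrow> (inst_right c \<phi> \<in> q \<longleftrightarrow> holds M c \<delta>)"
proof -
  define R where "R = (\<lambda>(a :: 'i \<Rightarrow> 'm) b. sat M (case_sum a b) \<phi>)"
  define bad where "bad N \<longleftrightarrow>
      (\<exists>F. finite F \<and> F \<subseteq> q \<and> \<not> branching R N {a. realizes M a F} UNIV)" for N
  have "\<exists>N. bad N" using fin by (auto simp: branches_infinitely_def bad_def R_def)
  moreover have "\<not> bad 0"
  proof -
    have "realizes M a F" if "F \<subseteq> q" for F using that by (auto simp: q tp_def realizes_def)
    then show ?thesis by (auto simp: bad_def)
  qed
  ultimately obtain m where m: "\<not> bad m" "bad (Suc m)" using nat_induct[of "\<lambda>N. \<not> bad N"] by blast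
  then obtain F where F: "finite F" "F \<subseteq> q" "\<not> branching R (Suc m) {a. realizes M a F} UNIV"
    by (auto simp: bad_def)
  have Ff: "F \<subseteq> fmlas L (I <+> C)" using F(2) by (auto simp: q tp_def)
  have R_def': "definable_over L M C (\<lambda>w. R (\<lambda>x. w (Inl x)) (\<lambda>j. w (Inr j)))"
    unfolding R_def by (rule definable_relation[OF \<phi>])
  have "definable_over L M C (\<lambda>w :: 'i + nat \<Rightarrow> 'm. realizes M (\<lambda>x. w (Inl x)) F)"
    by (rule definable_rename[OF definable_realizes[OF F(1) Ff], where f = Inl])
  then have "definable_over L M C (\<lambda>c. branching R m {a. realizes M a F \<and> R a c} UNIV)"
    using R_def' by (intro definable_branching definable_and)
  moreover have "depends_only {..<n} (\<lambda>c. branching R m {a. realizes M a F \<and> R a c} UNIV)"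
    unfolding depends_only_def
  proof (intro allI impI)
    fix c d :: "nat \<Rightarrow> 'm" assume "\<forall>j\<in>{..<n}. c j = d j"
    then have "R a c = R a d" for a
      unfolding R_def by (intro sat_cong) (use \<phi> in \<open>auto simp: fmlas_def split: sum.split\<close>)
    then show "branching R m {a. realizes M a F \<and> R a c} UNIV
        = branching R m {a. realizes M a F \<and> R a d} UNIV" by simp
  qed
  ultimately obtain \<delta> where \<delta>: "\<delta> \<in> fmlas L ({..<n} <+> C)"
    "\<And>c. holds M c \<delta> \<longleftrightarrow> branching R m {a. realizes M a F \<and> R a c} UNIV"
    using definable_formula by blast
  have "inst_right c \<phi> \<in> q \<longleftrightarrow> holds M c \<delta>" if c: "c ` {..<n} \<subseteq> C" for c
  proof
    assume "inst_right c \<phi> \<in> q"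
    then have "branching R m {a. realizes M a (insert (inst_right c \<phi>) F)} UNIV"
      using m(1) F by (auto simp: bad_def)
    moreover have "{a. realizes M a (insert (inst_right c \<phi>) F)} = {a. realizes M a F \<and> R a c}"
      by (auto simp: realizes_def holds_inst_right R_def)
    ultimately show "holds M c \<delta>" using \<delta>(2) by simp
  next
    assume c\<delta>: "holds M c \<delta>"
    show "inst_right c \<phi> \<in> q"
    proof (rule ccontr)
      assume "inst_right c \<phi> \<notin> q"
      then have "Neg (inst_right c \<phi>) \<in> q" using inst_right_in_fmlas[OF \<phi> c] by (simp add: q tp_def)
      then have "branching R m {a. realizes M a (insert (Neg (inst_right c \<phi>)) F)} UNIV"
        using m(1) F by (auto simp: bad_def)
      moreover have "{a. realizes M a (insert (Neg (inst_right c \<phi>)) F)}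
          = {a \<in> {a. realizes M a F}. \<not> R a c}"
        by (auto simp: realizes_def holds_inst_right R_def)
      moreover have "branching R m {a \<in> {a. realizes M a F}. R a c} UNIV" using c\<delta> \<delta>(2) by simp
      ultimately have "branching R (Suc m) {a. realizes M a F} UNIV" by auto
      then show False using F(3) by simp
    qed
  qed
  then show ?thesis using \<delta>(1) by blast
qed

section \<open>Transfer of infinite rank\<close>

definition has_ladder ::
  "('f, 'r, 'm) struct \<Rightarrow> ('f, 'r, 'i + nat) fm \<Rightarrow> nat \<Rightarrow> (nat \<times> 'i \<Rightarrow> 'm) \<Rightarrow> bool" where
  "has_ladder M \<phi> N \<alpha> \<longleftrightarrow> (\<exists>\<beta> :: nat \<times> nat \<Rightarrow> 'm. \<forall>i\<in>{..<N}. \<forall>j\<in>{..<N}.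
     sat M (case_sum (\<lambda>x. \<alpha> (i, x)) (\<lambda>k. \<beta> (j, k))) \<phi> \<longleftrightarrow> i \<le> j)"

lemma definable_has_ladder:
  fixes M :: "('f, 'r, 'm) struct" and \<phi> :: "('f, 'r, 'i + nat) fm"
  assumes "\<phi> \<in> fmlas L V"
  shows "definable_over L M C (has_ladder M \<phi> N)"
proof -
  have entry: "definable_over L M C (\<lambda>w :: nat \<times> 'i + nat \<times> nat \<Rightarrow> 'm.
      sat M (\<lambda>z. w (map_sum (Pair i) (Pair j) z)) \<phi>)" for i j
    by (rule definable_rename[OF definable_sat[OF assms], where f = "map_sum (Pair i) (Pair j)"])
  have "definable_over L M C (\<lambda>w :: nat \<times> 'i + nat \<times> nat \<Rightarrow> 'm.
      \<forall>i\<in>{..<N}. \<forall>j\<in>{..<N}. sat M (\<lambda>z. w (map_sum (Pair i) (Pair j) z)) \<phi> \<longleftrightarrow> i \<le> j)"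
    by (intro definable_Ball definable_iff definable_const entry) simp_all
  from definable_ex[OF this]
  have ex: "definable_over L M C (\<lambda>\<alpha>. \<exists>\<beta>. \<forall>i\<in>{..<N}. \<forall>j\<in>{..<N}.
      sat M (\<lambda>z. case_sum \<alpha> \<beta> (map_sum (Pair i) (Pair j) z)) \<phi> \<longleftrightarrow> i \<le> j)" .
  have eq: "(\<lambda>z. case_sum \<alpha> \<beta> (map_sum (Pair i) (Pair j) z))
      = case_sum (\<lambda>x. \<alpha> (i, x)) (\<lambda>k. \<beta> (j, k))"
    for \<alpha> :: "nat \<times> 'i \<Rightarrow> 'm" and \<beta> :: "nat \<times> nat \<Rightarrow> 'm" and i j
    by (auto simp: fun_eq_iff split: sum.split)
  show ?thesis using ex by (simp only: eq has_ladder_def[abs_def])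
qed

lemma depends_only_has_ladder:
  fixes M :: "('f, 'r, 'm) struct" and \<phi> :: "('f, 'r, 'i + nat) fm"
  assumes "\<phi> \<in> fmlas L (I <+> Y)"
  shows "depends_only (UNIV \<times> I) (has_ladder M \<phi> N)"
  unfolding depends_only_def
proof (intro allI impI)
  fix \<alpha> \<beta> :: "nat \<times> 'i \<Rightarrow> 'm" assume "\<forall>z\<in>UNIV \<times> I. \<alpha> z = \<beta> z"
  then have "sat M (case_sum (\<lambda>x. \<alpha> (i, x)) b) \<phi> = sat M (case_sum (\<lambda>x. \<beta> (i, x)) b) \<phi>" for i b
    by (intro sat_cong) (use assms in \<open>auto simp: fmlas_def split: sum.split\<close>)
  then show "has_ladder M \<phi> N \<alpha> = has_ladder M \<phi> N \<beta>" by (simp add: has_ladder_def)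
qed

lemma has_ladder_subsequence:
  assumes "has_ladder M \<phi> N' (\<lambda>(i, x). \<alpha> i x)" and "strict_mono_on {..<N} e" and "e ` {..<N} \<subseteq> {..<N'}"
  shows "has_ladder M \<phi> N (\<lambda>(i, x). \<alpha> (e i) x)"
proof -
  obtain \<beta> where \<beta>: "\<forall>i\<in>{..<N'}. \<forall>j\<in>{..<N'}. sat M (case_sum (\<alpha> i) (\<lambda>k. \<beta> (j, k))) \<phi> \<longleftrightarrow> i \<le> j"
    using assms(1) by (auto simp: has_ladder_def)
  have "e i \<le> e j \<longleftrightarrow> i \<le> j" if "i < N" "j < N" for i j
    using assms(2) that by (simp add: strict_mono_on_less_eq)
  moreover have "e i < N'" if "i < N" for i using assms(3) that by auto
  ultimately show ?thesis
    unfolding has_ladder_def by (intro exI[of _ "\<lambda>(j, k). \<beta> (e j, k)"]) (use \<beta> in simp)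
qed

lemma has_ladder_antimono: "N \<le> N' \<Longrightarrow> has_ladder M \<phi> N' \<alpha> \<Longrightarrow> has_ladder M \<phi> N \<alpha>"
  using has_ladder_subsequence[of M \<phi> N' "\<lambda>i x. \<alpha> (i, x)" N "\<lambda>i. i"]
  by (auto simp: strict_mono_on_def)

text \<open>Trees themselves do not transfer, as \<open>noncodividing_transfer\<close> requires a property that is inherited
  by subsequences; hence the detour through half graphs.\<close>

lemma branches_infinitely_transfer:
  fixes M :: "('f, 'r, 'm) struct" and I :: "'i set"
  assumes monster: "monster_model L T \<kappa> M" and I: "|I| <o \<kappa>" and B: "|B| <o \<kappa>" and AB: "A \<subseteq> B"
    and p: "p \<in> complete_types L M I B" and nc: "\<not> codivides L M I A B p"
    and \<phi>: "\<phi> \<in> fmlas L (I <+> {..<n::nat})"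
    and br: "branches_infinitely M \<phi> (restrict_type L I p A)"
  shows "branches_infinitely M \<phi> p"
proof -
  define R where "R = (\<lambda>(a :: 'i \<Rightarrow> 'm) b. sat M (case_sum a b) \<phi>)"
  have A: "|A| <o \<kappa>" using AB B card_of_mono1 ordLeq_ordLess_trans by blast
  have sub: "restrict_type L I p A \<subseteq> fmlas L (I <+> A)" by (auto simp: restrict_type_def)
  obtain \<alpha> where \<alpha>: "\<forall>i. realizes M (\<lambda>x. \<alpha> (i, x)) (restrict_type L I p A)"
    and lad: "\<forall>N. has_ladder M \<phi> N \<alpha>"
  proof (rule sequence_compactness[where P = "has_ladder M \<phi>", OF monster I A sub
        definable_has_ladder[OF \<phi>] depends_only_has_ladder[OF \<phi>] has_ladder_antimono])
    fix F N assume F: "finite F" "F \<subseteq> restrict_type L I p A"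
    obtain N' where "\<And>X Y. branching R N' X Y \<Longrightarrow> ladder R N X Y"
      using branching_imp_ladder[of R N] by blast
    then have "ladder R N {a. realizes M a F} UNIV"
      using branches_infinitelyD[OF br F] unfolding R_def by blast
    then obtain a b where ab: "\<forall>i<N. a i \<in> {a. realizes M a F} \<and> b i \<in> UNIV"
      "\<forall>i<N. \<forall>j<N. R (a i) (b j) \<longleftrightarrow> i \<le> j"
      unfolding ladder_def by (elim exE conjE) (rule that)
    have "has_ladder M \<phi> N (\<lambda>(i, x). a i x)"
      unfolding has_ladder_def
      by (intro exI[of _ "\<lambda>(j, k). b j k"]) (use ab(2) in \<open>auto simp: R_def\<close>)
    then show "\<exists>\<beta>. (\<forall>i<N. \<forall>\<theta>\<in>F. holds M (\<lambda>x. \<beta> (i, x)) \<theta>) \<and> has_ladder M \<phi> N \<beta>"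
      using ab(1) by (intro exI[of _ "\<lambda>(i, x). a i x"]) (auto simp: realizes_def)
  qed
  have her: "has_ladder M \<phi> N (\<lambda>(i, x). \<alpha> (e i, x))" if "strict_mono_on {..<N} e" for N e
  proof -
    obtain N' where "e ` {..<N} \<subseteq> {..<N'}" using finite_nat_bounded[of "e ` {..<N}"] by blast
    then show ?thesis
      using has_ladder_subsequence[of M \<phi> N' "\<lambda>i x. \<alpha> (i, x)" N e] lad that \<open>e ` {..<N} \<subseteq> {..<N'}\<close> by simp
  qed
  obtain \<beta> where \<beta>: "\<forall>i. realizes M (\<lambda>x. \<beta> (i, x)) p" and lad': "\<forall>N. has_ladder M \<phi> N \<beta>"
    by (rule noncodividing_transfer[where P = "has_ladder M \<phi>" and \<alpha> = "\<lambda>i x. \<alpha> (i, x)",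
          OF monster I B AB p nc \<alpha>[rule_format] definable_has_ladder[OF \<phi>] depends_only_has_ladder[OF \<phi>]
          has_ladder_antimono her])
  show ?thesis
    unfolding branches_infinitely_def R_def[symmetric]
  proof (intro allI impI)
    fix F N assume F: "finite F \<and> F \<subseteq> p"
    obtain b where b: "\<forall>i\<in>{..<2 ^ N}. \<forall>j\<in>{..<2 ^ N}.
        sat M (case_sum (\<lambda>x. \<beta> (i, x)) (\<lambda>k. b (j, k))) \<phi> \<longleftrightarrow> i \<le> j"
      using lad'[rule_format, of "2 ^ N"] unfolding has_ladder_def by (elim exE) (rule that)
    have "ladder R (2 ^ N) {a. realizes M a F} UNIV"
      unfolding ladder_def
      by (rule exI[of _ "\<lambda>i x. \<beta> (i, x)"], rule exI[of _ "\<lambda>j k. b (j, k)"])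
        (use b \<beta> F in \<open>auto simp: R_def realizes_def\<close>)
    then show "branching R N {a. realizes M a F} UNIV" by (rule ladder_imp_branching)
  qed
qed

section \<open>A nondefinable extension of a type of infinite rank\<close>

text \<open>By compactness it suffices that \<open>c\<close> and \<open>d\<close> agree on finitely many formulas \<open>\<Delta>\<close> and leave rank
  at least \<open>N\<close>, for a given \<open>N\<close>. Colouring the nodes of a high tree by their \<open>\<Delta>\<close>-types leaves a tree of height \<open>N + 2\<close> with
  nodes of a single \<open>\<Delta>\<close>-type. Take for \<open>c\<close> its root and for \<open>d\<close> the node below it on the side of
  \<open>\<not> \<phi>(x, c)\<close>.\<close>

lemma branching_equivalent_pair:
  fixes M :: "('f, 'r, 'm) struct" and I :: "'i set"
  assumes monster: "monster_model L T \<kappa> M" and D: "|D| <o \<kappa>"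
    and \<pi>: "\<pi> \<subseteq> fmlas L (I <+> D)" and \<phi>: "\<phi> \<in> fmlas L (I <+> {..<n::nat})"
    and br: "branches_infinitely M \<phi> \<pi>"
  obtains c d where "tp L M {..<n} c D = tp L M {..<n} d D"
    and "branches_infinitely M \<phi> (\<pi> \<union> {Neg (inst_right c \<phi>), inst_right d \<phi>})"
proof -
  define R where "R = (\<lambda>(a :: 'i \<Rightarrow> 'm) b. sat M (case_sum a b) \<phi>)"
  define agree where "agree \<delta> v \<longleftrightarrow> (holds M (\<lambda>j. v (Inl j)) \<delta> \<longleftrightarrow> holds M (\<lambda>j. v (Inr j)) \<delta>)"
    for \<delta> :: "('f, 'r, nat + 'm) fm" and v :: "nat + nat \<Rightarrow> 'm"
  define wide where "wide F N v \<longleftrightarrow> branching R N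
      {a. realizes M a F \<and> \<not> R a (\<lambda>j. v (Inl j)) \<and> R a (\<lambda>j. v (Inr j))} UNIV"
    for F :: "('f, 'r, 'i + 'm) fm set" and N and v :: "nat + nat \<Rightarrow> 'm"
  define \<P> where "\<P> = agree ` fmlas L ({..<n} <+> D) \<union> {wide F N |F N. finite F \<and> F \<subseteq> \<pi>}"
  define K where "K = {(\<Delta>, F, N :: nat). finite \<Delta> \<and> \<Delta> \<subseteq> fmlas L ({..<n} <+> D) \<and> finite F \<and> F \<subseteq> \<pi>}"
  define S where "S = (\<lambda>(\<Delta>, F, N) v. (\<forall>\<delta>\<in>\<Delta>. agree \<delta> v) \<and> wide F N v)"
  have wide_mono: "wide F1 N1 v" if "wide F2 N2 v" "F1 \<subseteq> F2" "N1 \<le> N2" for F1 F2 N1 N2 v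
  proof -
    have "wide F2 N1 v" using that(1,3) branching_antimono unfolding wide_def by blast
    then show ?thesis
      unfolding wide_def by (rule branching_mono) (use that(2) in \<open>auto simp: realizes_def\<close>)
  qed
  have small: "|UNIV :: (nat + nat) set| <o \<kappa>"
    by (rule small_countable[OF monster]) simp
  obtain v where v: "\<forall>Q\<in>\<P>. Q v"
  proof (rule definable_saturation_directed[OF monster small D])
    fix Q assume "Q \<in> \<P>"
    then consider \<delta> where "\<delta> \<in> fmlas L ({..<n} <+> D)" "Q = agree \<delta>"
      | F N where "finite F" "F \<subseteq> \<pi>" "Q = wide F N"
      by (auto simp: \<P>_def)
    then show "definable_over L M D Q"
    proof cases
      case 1
      show ?thesis
        unfolding 1(2) agree_def[abs_def]
        by (rule definable_iff[OF definable_rename[OF definable_holds[OF 1(1)], where f = Inl]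
              definable_rename[OF definable_holds[OF 1(1)], where f = Inr]])
    next
      case 2
      let ?l = "\<lambda>j. sum_encode (Inl j)" and ?r = "\<lambda>j. sum_encode (Inr j)"
      have R: "definable_over L M D (\<lambda>w. R (\<lambda>x. w (Inl x)) (\<lambda>j. w (Inr j)))"
        unfolding R_def by (rule definable_relation[OF \<phi>])
      have Rl: "definable_over L M D (\<lambda>w. R (\<lambda>x. w (Inl x)) (\<lambda>j. w (Inr (?l j))))"
        using definable_rename[OF R, where f = "map_sum id ?l"] by simp
      have Rr: "definable_over L M D (\<lambda>w. R (\<lambda>x. w (Inl x)) (\<lambda>j. w (Inr (?r j))))"
        using definable_rename[OF R, where f = "map_sum id ?r"] by simp
      have "F \<subseteq> fmlas L (I <+> D)" using 2 \<pi> by blast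
      then have "definable_over L M D (\<lambda>w :: 'i + nat \<Rightarrow> 'm. realizes M (\<lambda>x. w (Inl x)) F)"
        by (rule definable_rename[OF definable_realizes[OF 2(1)], where f = Inl])
      from definable_and[OF this definable_and[OF definable_not[OF Rl] Rr]]
      have "definable_over L M D (\<lambda>c. branching R N
          {a. realizes M a F \<and> \<not> R a (\<lambda>j. c (?l j)) \<and> R a (\<lambda>j. c (?r j))} UNIV)"
        by (rule definable_branching[OF R,
              of "\<lambda>a c. realizes M a F \<and> \<not> R a (\<lambda>j. c (?l j)) \<and> R a (\<lambda>j. c (?r j))"])
      from definable_rename[OF this, where f = sum_decode]
      show ?thesis unfolding 2(3) wide_def[abs_def] by simp
    qed
    show "depends_only UNIV Q" by (simp add: depends_only_def fun_eq_iff[symmetric])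
    show "\<exists>k\<in>K. \<forall>v. S k v \<longrightarrow> Q v"
      using \<open>Q \<in> \<P>\<close> unfolding \<P>_def
    proof (elim UnE imageE CollectE exE conjE)
      fix \<delta> assume "\<delta> \<in> fmlas L ({..<n} <+> D)" "Q = agree \<delta>"
      then show ?thesis by (intro bexI[of _ "({\<delta>}, {}, 0)"]) (simp_all add: S_def K_def)
    next
      fix F N assume "finite F" "F \<subseteq> \<pi>" "Q = wide F N"
      then show ?thesis by (intro bexI[of _ "({}, F, N)"]) (simp_all add: S_def K_def)
    qed
  next
    show "K \<noteq> {}" by (auto simp: K_def)
    fix k l assume kl: "k \<in> K" "l \<in> K"
    obtain \<Delta> F N \<Delta>' F' N' where eq: "k = (\<Delta>, F, N)" "l = (\<Delta>', F', N')" by (cases k, cases l)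
    have "S k v \<and> S l v" if v: "S (\<Delta> \<union> \<Delta>', F \<union> F', max N N') v" for v
    proof -
      have w: "wide (F \<union> F') (max N N') v" using v by (simp add: S_def)
      have "wide F N v" "wide F' N' v" by (rule wide_mono[OF w]; simp)+
      then show ?thesis using v by (simp add: S_def eq)
    qed
    then show "\<exists>m\<in>K. \<forall>v. S m v \<longrightarrow> S k v \<and> S l v"
      using kl eq by (intro bexI[of _ "(\<Delta> \<union> \<Delta>', F \<union> F', max N N')"]) (simp_all add: K_def)
  next
    fix k assume k: "k \<in> K"
    obtain \<Delta> F N where eq: "k = (\<Delta>, F, N)" by (cases k)
    have \<Delta>: "finite \<Delta>" and F: "finite F" "F \<subseteq> \<pi>" using k by (simp_all add: K_def eq)
    let ?X = "{a. realizes M a F}"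
    have "finite ((\<lambda>\<delta> b. holds M b \<delta>) ` \<Delta>)" using \<Delta> by simp
    then obtain Y where "Y \<subseteq> UNIV" and Y: "\<forall>N. branching R N ?X Y"
      and hom: "\<forall>\<delta>\<in>(\<lambda>\<delta> b. holds M b \<delta>) ` \<Delta>. \<forall>b\<in>Y. \<forall>c\<in>Y. \<delta> b \<longleftrightarrow> \<delta> c"
    proof (rule branching_homogeneous)
      show "branching R N ?X UNIV" for N unfolding R_def by (rule branches_infinitelyD[OF br F])
    qed
    obtain c where c: "c \<in> Y" "branching R (Suc N) {a \<in> ?X. \<not> R a c} Y"
      using Y[rule_format, of "Suc (Suc N)"] by auto
    then obtain d where d: "d \<in> Y" "branching R N {a \<in> {a \<in> ?X. \<not> R a c}. R a d} Y" by auto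
    have "branching R N {a. realizes M a F \<and> \<not> R a c \<and> R a d} UNIV"
      by (rule branching_mono[OF d(2)]) auto
    then have "wide F N (case_sum c d)" by (simp add: wide_def)
    moreover have "agree \<delta> (case_sum c d)" if "\<delta> \<in> \<Delta>" for \<delta>
      using hom[rule_format, OF imageI[OF that] c(1) d(1)] by (simp add: agree_def)
    ultimately show "\<exists>v. S k v" by (intro exI[of _ "case_sum c d"]) (simp add: S_def eq)
  qed
  let ?c = "\<lambda>j. v (Inl j)" and ?d = "\<lambda>j. v (Inr j)"
  have "holds M ?c \<delta> \<longleftrightarrow> holds M ?d \<delta>" if "\<delta> \<in> fmlas L ({..<n} <+> D)" for \<delta>
    using v[rule_format, of "agree \<delta>"] that by (simp add: \<P>_def agree_def)
  then have "tp L M {..<n} ?c D = tp L M {..<n} ?d D" by (auto simp: tp_def)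
  moreover have "branches_infinitely M \<phi> (\<pi> \<union> {Neg (inst_right ?c \<phi>), inst_right ?d \<phi>})"
    unfolding branches_infinitely_def R_def[symmetric]
  proof (intro allI impI)
    fix F N assume F: "finite F \<and> F \<subseteq> \<pi> \<union> {Neg (inst_right ?c \<phi>), inst_right ?d \<phi>}"
    have "wide (F \<inter> \<pi>) N v" by (rule v[rule_format, of "wide (F \<inter> \<pi>) N"]) (use F in \<open>auto simp: \<P>_def\<close>)
    then show "branching R N {a. realizes M a F} UNIV"
      unfolding wide_def
    proof (rule branching_mono)
      show "{a. realizes M a (F \<inter> \<pi>) \<and> \<not> R a ?c \<and> R a ?d} \<subseteq> {a. realizes M a F}"
      proof
        fix a assume "a \<in> {a. realizes M a (F \<inter> \<pi>) \<and> \<not> R a ?c \<and> R a ?d}"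
        then have a: "realizes M a (F \<inter> \<pi>)" "\<not> holds M a (inst_right ?c \<phi>)" "holds M a (inst_right ?d \<phi>)"
          by (auto simp: R_def holds_inst_right)
        then have "holds M a \<theta>" if "\<theta> \<in> F" for \<theta>
          using that F by (cases "\<theta> \<in> \<pi>") (auto simp: realizes_def)
        then show "a \<in> {a. realizes M a F}" by (simp add: realizes_def)
      qed
    qed simp
  qed
  ultimately show ?thesis by (rule that)
qed

text \<open>A formula over the parameters collected in \<open>\<omega>\<close> steps is a formula over those of some stage. The
  \<open>c\<close> and \<open>d\<close> chosen next have the same type over this stage, but \<open>\<phi>(x, c)\<close> is excluded from the
  completion and \<open>\<phi>(x, d)\<close> belongs to it.\<close>

lemma branches_infinitely_imp_unstable:
  fixes M :: "('f, 'r, 'm) struct" and I :: "'i set"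
  assumes monster: "monster_model L T \<kappa> M" and I: "|I| <o \<kappa>" and B: "|B| <o \<kappa>"
    and p: "p \<subseteq> fmlas L (I <+> B)" and \<phi>: "\<phi> \<in> fmlas L (I <+> {..<n::nat})"
    and br: "branches_infinitely M \<phi> p"
  shows "\<not> stable_type L M \<kappa> I B p"
proof -
  \<comment> \<open>A state of the construction is a set \<open>D\<close> of parameters with a set \<open>\<pi>\<close> of formulas over it. Countability
    of \<open>D - B\<close>, unlike mere smallness of \<open>D\<close>, is preserved in the limit even for singular \<open>\<kappa>\<close>.\<close>
  define good where "good = (\<lambda>(D, \<pi>). B \<subseteq> D \<and> countable (D - B) \<and> p \<subseteq> \<pi> \<and> \<pi> \<subseteq> fmlas L (I <+> D) \<and>
      branches_infinitely M \<phi> \<pi>)"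
  define step where "step = (\<lambda>(D, \<pi>) (D', \<pi>'). D \<subseteq> D' \<and> \<pi> \<subseteq> \<pi>' \<and>
      (\<exists>c d. c ` {..<n} \<subseteq> D' \<and> d ` {..<n} \<subseteq> D' \<and> tp L M {..<n} c D = tp L M {..<n} d D \<and>
        Neg (inst_right c \<phi>) \<in> \<pi>' \<and> inst_right d \<phi> \<in> \<pi>'))"
  have small: "|D| <o \<kappa>" if "B \<subseteq> D" "countable (D - B)" for D
  proof -
    have "|B \<union> (D - B)| <o \<kappa>" by (rule small_Un[OF monster B small_countable[OF monster that(2)]])
    moreover have "B \<union> (D - B) = D" using that(1) by blast
    ultimately show ?thesis by simp
  qed
  have "\<exists>f. \<forall>k. good (f k) \<and> step (f k) (f (Suc k))"
  proof (rule dependent_nat_choice)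
    have "good (B, p)" using p br by (simp add: good_def)
    then show "\<exists>x. good x" ..
    fix x assume "good x"
    obtain D \<pi> where x: "x = (D, \<pi>)" by (cases x)
    have D: "B \<subseteq> D" "countable (D - B)" and \<pi>: "p \<subseteq> \<pi>" "\<pi> \<subseteq> fmlas L (I <+> D)"
      "branches_infinitely M \<phi> \<pi>" using \<open>good x\<close> by (auto simp: good_def x)
    obtain c d where cd: "tp L M {..<n} c D = tp L M {..<n} d D"
      "branches_infinitely M \<phi> (\<pi> \<union> {Neg (inst_right c \<phi>), inst_right d \<phi>})"
      by (rule branching_equivalent_pair[OF monster small[OF D] \<pi>(2) \<phi> \<pi>(3)])
    let ?D = "D \<union> (c ` {..<n} \<union> d ` {..<n})" and ?\<pi> = "\<pi> \<union> {Neg (inst_right c \<phi>), inst_right d \<phi>}"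
    have "?D - B \<subseteq> (D - B) \<union> (c ` {..<n} \<union> d ` {..<n})" by blast
    then have "countable (?D - B)" by (rule countable_subset) (simp add: D(2) countable_finite)
    moreover have "fmlas L (I <+> D) \<subseteq> fmlas L (I <+> ?D)" by (rule fmlas_mono) auto
    moreover have "inst_right c \<phi> \<in> fmlas L (I <+> ?D)" "inst_right d \<phi> \<in> fmlas L (I <+> ?D)"
      by (rule inst_right_in_fmlas[OF \<phi>]; blast)+
    ultimately have "good (?D, ?\<pi>)" using D \<pi> cd(2) by (auto simp: good_def)
    moreover have "step x (?D, ?\<pi>)" unfolding x step_def using cd(1) by auto
    ultimately show "\<exists>y. good y \<and> step x y" by blast
  qed
  then obtain f where f: "\<And>k. good (f k)" "\<And>k. step (f k) (f (Suc k))" by blast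
  define D where "D k = fst (f k)" for k
  define \<pi> where "\<pi> k = snd (f k)" for k
  have good: "B \<subseteq> D k" "countable (D k - B)" "p \<subseteq> \<pi> k" "\<pi> k \<subseteq> fmlas L (I <+> D k)"
    "branches_infinitely M \<phi> (\<pi> k)" for k
    using f(1)[of k] by (auto simp: good_def D_def \<pi>_def case_prod_beta)
  have step: "D k \<subseteq> D (Suc k)" "\<pi> k \<subseteq> \<pi> (Suc k)"
    "\<exists>c d. c ` {..<n} \<subseteq> D (Suc k) \<and> d ` {..<n} \<subseteq> D (Suc k) \<and> tp L M {..<n} c (D k) = tp L M {..<n} d (D k) \<and>
        Neg (inst_right c \<phi>) \<in> \<pi> (Suc k) \<and> inst_right d \<phi> \<in> \<pi> (Suc k)" for k
    using f(2)[of k] by (auto simp: step_def D_def \<pi>_def case_prod_beta)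
  have chain: "\<exists>k. F \<subseteq> E k" if "finite F" "F \<subseteq> (\<Union>k. E k)" "\<And>k. E k \<subseteq> E (Suc k)"
    for F :: "'z set" and E :: "nat \<Rightarrow> 'z set"
  proof -
    have mono: "E i \<subseteq> E j" if "i \<le> j" for i j
      using that \<open>\<And>k. E k \<subseteq> E (Suc k)\<close> by (rule lift_Suc_mono_le[rotated])
    have "\<forall>x\<in>F. \<exists>k. x \<in> E k" using that(2) by blast
    then obtain g where g: "\<And>x. x \<in> F \<Longrightarrow> x \<in> E (g x)" by metis
    have "F \<subseteq> E (Max (g ` F))"
    proof
      fix x assume "x \<in> F"
      then have "g x \<le> Max (g ` F)" using that(1) by simp
      then show "x \<in> E (Max (g ` F))" using g[OF \<open>x \<in> F\<close>] mono by blast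
    qed
    then show ?thesis ..
  qed
  let ?C = "\<Union>k. D k" and ?\<pi> = "\<Union>k. \<pi> k"
  have BC: "B \<subseteq> ?C" using good(1) by blast
  have "countable (\<Union>k. D k - B)" by (intro countable_UN) (simp_all add: good(2))
  moreover have "(\<Union>k. D k - B) = ?C - B" by blast
  ultimately have "countable (?C - B)" by (rule back_subst)
  then have C: "|?C| <o \<kappa>" by (rule small[OF BC])
  have "consistent M ?\<pi>"
    unfolding consistent_def
  proof (intro allI impI)
    fix F assume F: "finite F \<and> F \<subseteq> ?\<pi>"
    then obtain k where "F \<subseteq> \<pi> k" using chain[of F \<pi>] step(2) by blast
    then have "branching (\<lambda>a b. sat M (case_sum a b) \<phi>) 0 {a. realizes M a F} UNIV"
      using branches_infinitelyD[OF good(5)] F by blast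
    then show "\<exists>a. realizes M a F" by auto
  qed
  moreover have "?\<pi> \<subseteq> fmlas L (I <+> ?C)"
  proof -
    have "fmlas L (I <+> D k) \<subseteq> fmlas L (I <+> ?C)" for k by (rule fmlas_mono) auto
    then show ?thesis using good(4) by blast
  qed
  ultimately obtain a where a: "realizes M a ?\<pi>" using saturation[OF monster I C] by blast
  define q where "q = tp L M I a ?C"
  have \<pi>q: "?\<pi> \<subseteq> q" using a \<open>?\<pi> \<subseteq> fmlas L (I <+> ?C)\<close> by (auto simp: q_def tp_def realizes_def)
  have "\<not> definable_type L M I ?C q"
  proof
    assume "definable_type L M I ?C q"
    then obtain \<delta> where \<delta>: "\<delta> \<in> fmlas L ({..<n} <+> ?C)"
      "\<And>c. c ` {..<n} \<subseteq> ?C \<Longrightarrow> inst_right c \<phi> \<in> q \<longleftrightarrow> holds M c \<delta>"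
      using \<phi> unfolding definable_type_def by blast
    have "finite (Inr -` fv \<delta>)" using finite_fv[of \<delta>] by (simp add: finite_vimageI)
    moreover have "Inr -` fv \<delta> \<subseteq> ?C" using \<delta>(1) by (auto simp: fmlas_def)
    ultimately obtain k where k: "Inr -` fv \<delta> \<subseteq> D k" using chain[of "Inr -` fv \<delta>" D] step(1) by blast
    have "fv \<delta> \<subseteq> {..<n} <+> D k"
    proof
      fix z assume z: "z \<in> fv \<delta>"
      then have "z \<in> {..<n} <+> ?C" using \<delta>(1) by (auto simp: fmlas_def)
      then show "z \<in> {..<n} <+> D k" by (rule PlusE) (use k z in auto)
    qed
    then have \<delta>': "\<delta> \<in> fmlas L ({..<n} <+> D k)" using \<delta>(1) by (simp add: fmlas_def)
    obtain c d where cd: "c ` {..<n} \<subseteq> D (Suc k)" "d ` {..<n} \<subseteq> D (Suc k)"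
      "tp L M {..<n} c (D k) = tp L M {..<n} d (D k)"
      "Neg (inst_right c \<phi>) \<in> \<pi> (Suc k)" "inst_right d \<phi> \<in> \<pi> (Suc k)" using step(3)[of k] by blast
    have "holds M c \<delta> \<longleftrightarrow> holds M d \<delta>" using cd(3) \<delta>' by (auto simp: tp_def)
    moreover have "inst_right d \<phi> \<in> q" using cd(5) \<pi>q by blast
    moreover have "Neg (inst_right c \<phi>) \<in> q" using cd(4) \<pi>q by blast
    then have "inst_right c \<phi> \<notin> q" by (auto simp: q_def tp_def)
    moreover have "c ` {..<n} \<subseteq> ?C" "d ` {..<n} \<subseteq> ?C" using cd(1,2) by blast+
    ultimately show False using \<delta>(2) by blast
  qed
  moreover have "p \<subseteq> q" using good(3)[of 0] \<pi>q by blast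
  moreover have "q \<in> complete_types L M I ?C" unfolding q_def by (rule tp_in_complete_types)
  ultimately show ?thesis unfolding stable_type_def using BC C by blast
qed

section \<open>Restrictions of NIP and stable types\<close>

theorem proposition3p3:
  fixes L :: "('f, 'r) lang" and T :: "('f, 'r, nat) fm set" and \<kappa> :: "'k rel"
    and M :: "('f, 'r, 'm) struct" and I :: "'i set" and A B :: "'m set"
    and p :: "('f, 'r, 'i + 'm) fm set"
  assumes "complete_theory L T" and "monster_model L T \<kappa> M"
    and "|I| <o \<kappa>" and "A \<subseteq> B" and "|B| <o \<kappa>"
    and "p \<in> complete_types L M I B"
    and "\<not> codivides L M I A B p"
  shows "(NIP L M I p \<longrightarrow> NIP L M I (restrict_type L I p A)) \<and>
    (stable_type L M \<kappa> I B p \<longrightarrow> stable_type L M \<kappa> I A (restrict_type L I p A))"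
proof (intro conjI impI)
  show "NIP L M I (restrict_type L I p A)" if "NIP L M I p"
    using that has_IP_transfer[OF assms(2,3,5,4,6,7)] by (auto simp: NIP_def)
next
  assume stable: "stable_type L M \<kappa> I B p"
  have p: "p \<subseteq> fmlas L (I <+> B)" using assms(6) by (simp add: complete_types_def partial_type_def)
  show "stable_type L M \<kappa> I A (restrict_type L I p A)"
    unfolding stable_type_def definable_type_def
  proof (intro allI impI ballI)
    fix C q and n :: nat and \<phi>
    assume q: "A \<subseteq> C \<and> |C| <o \<kappa> \<and> q \<in> complete_types L M I C \<and> restrict_type L I p A \<subseteq> q"
      and \<phi>: "\<phi> \<in> fmlas L (I <+> {..<n})"
    obtain a where a: "q = tp L M I a C"
      using complete_type_realized[OF assms(2,3), of C q] q by blast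
    show "\<exists>\<delta>\<in>fmlas L ({..<n} <+> C). \<forall>c. c ` {..<n} \<subseteq> C \<longrightarrow> (inst_right c \<phi> \<in> q \<longleftrightarrow> holds M c \<delta>)"
    proof (rule not_branching_imp_defining_formula[OF \<phi> a], rule notI)
      assume "branches_infinitely M \<phi> q"
      then have "branches_infinitely M \<phi> (restrict_type L I p A)"
        using branches_infinitely_subset q by blast
      then have "branches_infinitely M \<phi> p"
        by (rule branches_infinitely_transfer[OF assms(2,3,5,4,6,7) \<phi>])
      then show False using branches_infinitely_imp_unstable[OF assms(2,3,5) p \<phi>] stable by blast
    qed
  qed
qed

end
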